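(* Let $D=\begin{pmatrix} I_r & M\end{pmatrix}$ be an $r\times n$ standard representative matrix and let $\mathfrak w\in\mathbb R^n$ be a shifting vector for $D$. Then the map $f_{\mathfrak w}:\mathcal S(D)\to\mathcal B(D)$ is well defined, i.e. every class $s\in\mathcal S(D)$ contains exactly one integer $\mathfrak w$-representative $z_s\in\mathbb Z^n$ and $z_s$ is $\mathfrak w$-associated with exactly one $B\in\mathcal B(D)$, and for every $B\in\mathcal B(D)$ we have $|f_{\mathfrak w}^{-1}(B)|=m(B)^2$.
   Context: Let $r\le n$ be nonnegative integers, $M$ an $r\times(n-r)$ integer matrix, $D=\begin{pmatrix} I_r & M\end{pmatrix}$, $\widehat D=\begin{pmatrix} -M^T & I_{n-r}\end{pmatrix}$ and $\mathbf D=\begin{pmatrix} I_r & M\\ -M^T & I_{n-r}\end{pmatrix}$. Let $\Lambda\subseteq\mathbb Z^n$ be the lattice generated by the rows of $\mathbf D$ (it equals $\operatorname{im}_{\mathbb Z}(D^T)\oplus\ker_{\mathbb Z}(D)$). The sandpile group is $\mathcal S(D)=\mathbb Z^n/\Lambda$. $\mathcal B(D)$ is the set of $r$-element subsets $B\subseteq[n]$ such that the $r\times r$ submatrix of $D$ on the columns indexed by $B$ has nonzero determinant, and $m(B)$ is the absolute value of that determinant. The fundamental parallelepiped of vectors $c_1,\dots,c_k$ is $\{\sum_i a_ic_i: 0\le a_i\le 1\}$. For $B\in\mathcal B(D)$, $P_1(B)\subseteq\mathbb R^r$ is the fundamental parallelepiped of the columns of $D$ indexed by $B$, $P_2(B)\subseteq\mathbb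 R^{n-r}$ is the fundamental parallelepiped of the columns of $\widehat D$ indexed by $[n]\setminus B$, and $P(B)=P_1(B)\times P_2(B)\subseteq\mathbb R^n$. Let $T(D)=\bigcup_{B\in\mathcal B(D)}P(B)$. A shifting vector is a vector $\mathfrak w\in\mathbb R^n$ which, for every $B\in\mathcal B(D)$, does not lie in the linear span of any facet of $P(B)$ (the $(n-1)$-dimensional linear subspace parallel to that facet). A point $z\in\mathbb Z^n$ is a $\mathfrak w$-representative (of $\mathcal S(D)$) if $z+\epsilon\mathfrak w\in T(D)$ for all sufficiently small $\epsilon>0$, and it is $\mathfrak w$-associated with $B$ if $z+\epsilon\mathfrak w\in P(B)$ for all sufficiently small $\epsilon>0$. The map $f_{\mathfrak w}$ sends a class $s\in\mathcal S(D)$ to the basis with which the $\mathfrak w$-representative in $s$ is $\mathfrak w$-associated. *)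

theory Defs
  imports
    Jordan_Normal_Form.DL_Submatrix
    Jordan_Normal_Form.VS_Connect
    "HOL-Algebra.Coset"
    Complex_Main
begin

(* Matrices and vectors have explicit natural-number dimensions, so that the degenerate cases
   r = 0, r = n and n = 0 are covered.  Coordinates and columns are numbered 0, ..., n - 1.
   The matrix M has r rows and n - r columns, so r and n are recovered from its dimensions. *)

definition row_num :: "int mat \<Rightarrow> nat" where
  "row_num M = dim_row M"

definition ground_size :: "int mat \<Rightarrow> nat" where
  "ground_size M = dim_row M + dim_col M"

(* The block matrix (A B), written with empty lower blocks. *)
definition append_cols :: "'a::zero mat \<Rightarrow> 'a mat \<Rightarrow> 'a mat" where
  "append_cols A B = four_block_mat A B (0\<^sub>m 0 (dim_col A)) (0\<^sub>m 0 (dim_col B))"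

definition std_rep_mat :: "int mat \<Rightarrow> int mat" where
  "std_rep_mat M = append_cols (1\<^sub>m (dim_row M)) M"

definition dual_rep_mat :: "int mat \<Rightarrow> int mat" where
  "dual_rep_mat M = append_cols (- M\<^sup>T) (1\<^sub>m (dim_col M))"

definition full_rep_mat :: "int mat \<Rightarrow> int mat" where
  "full_rep_mat M = four_block_mat (1\<^sub>m (dim_row M)) M (- M\<^sup>T) (1\<^sub>m (dim_col M))"

definition rep_lattice :: "int mat \<Rightarrow> int vec set" where
  "rep_lattice M = vec_module.lattice_of (ground_size M) (rows (full_rep_mat M))"

(* The elements of this quotient group are cosets, that is, sets of integer vectors. *)
definition sandpile_group :: "int mat \<Rightarrow> int vec set monoid" where
  "sandpile_group M = monoid_vec TYPE(int) (ground_size M) Mod rep_lattice M"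

definition basis_det :: "int mat \<Rightarrow> nat set \<Rightarrow> int" where
  "basis_det M B = det (submatrix (std_rep_mat M) UNIV B)"

definition bases :: "int mat \<Rightarrow> nat set set" where
  "bases M = {B. B \<subseteq> {0..<ground_size M} \<and> card B = row_num M \<and> basis_det M B \<noteq> 0}"

definition basis_mult :: "int mat \<Rightarrow> nat set \<Rightarrow> nat" where
  "basis_mult M B = nat \<bar>basis_det M B\<bar>"

(* The fundamental parallelepiped of the columns of C. *)
definition fund_parallelepiped :: "real mat \<Rightarrow> real vec set" where
  "fund_parallelepiped C =
     {C *\<^sub>v a | a. a \<in> carrier_vec (dim_col C) \<and> (\<forall>i<dim_col C. 0 \<le> a $ i \<and> a $ i \<le> 1)}"

definition P1 :: "int mat \<Rightarrow> nat set \<Rightarrow> real vec set" where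
  "P1 M B = fund_parallelepiped (map_mat real_of_int (submatrix (std_rep_mat M) UNIV B))"

definition P2 :: "int mat \<Rightarrow> nat set \<Rightarrow> real vec set" where
  "P2 M B = fund_parallelepiped (map_mat real_of_int
     (submatrix (dual_rep_mat M) UNIV ({0..<ground_size M} - B)))"

definition basis_cell :: "int mat \<Rightarrow> nat set \<Rightarrow> real vec set" where
  "basis_cell M B = {x @\<^sub>v y | x y. x \<in> P1 M B \<and> y \<in> P2 M B}"

definition tile :: "int mat \<Rightarrow> real vec set" where
  "tile M = (\<Union>B\<in>bases M. basis_cell M B)"

(* For nonempty F, the linear subspace parallel to the affine hull of F. *)
definition direction_space :: "nat \<Rightarrow> real vec set \<Rightarrow> real vec set" where
  "direction_space n F = LinearCombinations.module.span class_ring (module_vec TYPE(real) n)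
     {x - y | x y. x \<in> F \<and> y \<in> F}"

definition subspace_dim :: "nat \<Rightarrow> real vec set \<Rightarrow> nat" where
  "subspace_dim n W = vectorspace.dim class_ring ((module_vec TYPE(real) n)\<lparr>carrier := W\<rparr>)"

(* Nonempty faces of a polytope, cut out by valid inequalities u x <= c. *)
definition is_face :: "nat \<Rightarrow> real vec set \<Rightarrow> real vec set \<Rightarrow> bool" where
  "is_face n F P \<longleftrightarrow> F \<noteq> {} \<and>
     (\<exists>u\<in>carrier_vec n. \<exists>c. (\<forall>x\<in>P. u \<bullet> x \<le> c) \<and> F = {x \<in> P. u \<bullet> x = c})"

(* P is meant to be full-dimensional in R^n, so its facets have dimension n - 1.  The equation
   is written with + 1 so that for n = 0 there are no facets. *)
definition is_facet :: "nat \<Rightarrow> real vec set \<Rightarrow> real vec set \<Rightarrow> bool" where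
  "is_facet n F P \<longleftrightarrow> is_face n F P \<and> subspace_dim n (direction_space n F) + 1 = n"

definition shifting_vector :: "int mat \<Rightarrow> real vec \<Rightarrow> bool" where
  "shifting_vector M w \<longleftrightarrow> w \<in> carrier_vec (ground_size M) \<and>
     (\<forall>B\<in>bases M. \<forall>F. is_facet (ground_size M) F (basis_cell M B)
        \<longrightarrow> w \<notin> direction_space (ground_size M) F)"

definition w_representative :: "int mat \<Rightarrow> real vec \<Rightarrow> int vec \<Rightarrow> bool" where
  "w_representative M w z \<longleftrightarrow> z \<in> carrier_vec (ground_size M) \<and>
     (\<forall>\<^sub>F \<epsilon> in at_right 0. map_vec real_of_int z + \<epsilon> \<cdot>\<^sub>v w \<in> tile M)"

definition w_associated :: "int mat \<Rightarrow> real vec \<Rightarrow> int vec \<Rightarrow> nat set \<Rightarrow> bool" where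
  "w_associated M w z B \<longleftrightarrow>
     (\<forall>\<^sub>F \<epsilon> in at_right 0. map_vec real_of_int z + \<epsilon> \<cdot>\<^sub>v w \<in> basis_cell M B)"

definition class_rep :: "int mat \<Rightarrow> real vec \<Rightarrow> int vec set \<Rightarrow> int vec" where
  "class_rep M w s = (THE z. z \<in> s \<and> w_representative M w z)"

(* Meaningful only once the representative and its basis are known to exist uniquely. *)
definition basis_map :: "int mat \<Rightarrow> real vec \<Rightarrow> int vec set \<Rightarrow> nat set" where
  "basis_map M w s = (THE B. B \<in> bases M \<and> w_associated M w (class_rep M w s) B)"

end

theory Submission
  imports Defs "Jordan_Normal_Form.DL_Rank"
begin

text \<open>
  The cells overlap in no interior point, even modulo the lattice. Suppose the coordinate vectors
  \<open>a\<close> and \<open>a'\<close> of interior points of the cells of \<open>B\<close> and \<open>B'\<close> give points that differ by a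
  lattice vector, say \<open>(D v, - D' v)\<close> with \<open>v\<close> integral and \<open>D' = (-M\<^sup>T I)\<close>. Restricting \<open>a, a'\<close>
  to the bases (\<open>\<alpha>, \<alpha>'\<close>) and to their complements (\<open>\<beta>, \<beta>'\<close>), we get
  \<open>\<alpha> - \<alpha>' - v \<in> ker D\<close> and \<open>\<beta> - \<beta>' + v \<in> ker D'\<close>. These kernels are orthogonal, while every
  summand of the scalar product is nonpositive, and it vanishes at \<open>i\<close> only if \<open>v\<^sub>i = 0\<close> and \<open>B, B'\<close>
  agree at \<open>i\<close>.

  A generic shift makes each cell a half-open parallelepiped, which represents the integer points
  modulo its edge lattice exactly once and hence contains \<open>m(B)\<^sup>2\<close> of them. Expanding the determinant
  of the full matrix multilinearly in its columns shows that these numbers add up to the order of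
  the sandpile group, so the disjointness above already forces every class to be hit.
\<close>

section \<open>Representatives modulo an integer lattice\<close>

text \<open>The numbers add up because of a coincidence of signs. Putting the columns of a cell back
  into their original order turns its block matrix into one term of the multilinear expansion, at
  the cost of the sign of a permutation. The minor of the dual matrix on the complement of
  \<open>B\<close> equals the minor of \<open>D\<close> on \<open>B\<close> times the same sign. The
  two signs cancel, so every term is a square and the determinant of the full matrix is the sum of
  the absolute values of the cell determinants.

  Both sides of the comparison are lattice indices: that of the edge lattice of a cell, and that of
  the sandpile lattice. One fact about integer matrices serves both: a set of representatives modulo
  the columns has as many elements as the absolute determinant. For a cell it gives the number of
  points; for the sandpile lattice it is used in reverse, since that many pairwise incongruent
  points must represent every class. Lattices are spanned by columns here, which is why
  \<open>full_rep_mat M\<close> occurs transposed.\<close>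

definition lattice_cong :: "int mat \<Rightarrow> int vec \<Rightarrow> int vec \<Rightarrow> bool" where
  "lattice_cong A x y \<longleftrightarrow> (\<exists>v\<in>carrier_vec (dim_col A). x = y + A *\<^sub>v v)"

definition transversal :: "int mat \<Rightarrow> int vec set \<Rightarrow> bool" where
  "transversal A R \<longleftrightarrow> R \<subseteq> carrier_vec (dim_row A) \<and>
     (\<forall>x\<in>carrier_vec (dim_row A). \<exists>!y. y \<in> R \<and> lattice_cong A x y)"

lemma lattice_cong_refl: "x \<in> carrier_vec (dim_row A) \<Longrightarrow> lattice_cong A x x"
  unfolding lattice_cong_def by (intro bexI[of _ "0\<^sub>v (dim_col A)"]) auto

lemma lattice_cong_sym:
  assumes "lattice_cong A x y" and "y \<in> carrier_vec (dim_row A)"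
  shows "lattice_cong A y x"
proof -
  from assms(1) obtain v where v: "v \<in> carrier_vec (dim_col A)" "x = y + A *\<^sub>v v"
    by (auto simp: lattice_cong_def)
  have "A *\<^sub>v (- v) = - (A *\<^sub>v v)" using v by (intro eq_vecI) auto
  then have "y = x + A *\<^sub>v (- v)" using v assms(2) by (intro eq_vecI) auto
  then show ?thesis using v(1) unfolding lattice_cong_def by (intro bexI[of _ "- v"]) auto
qed

lemma lattice_cong_trans:
  assumes "lattice_cong A x y" and "lattice_cong A y z" and "z \<in> carrier_vec (dim_row A)"
  shows "lattice_cong A x z"
proof -
  from assms obtain u v where u: "u \<in> carrier_vec (dim_col A)" "x = y + A *\<^sub>v u"
    and v: "v \<in> carrier_vec (dim_col A)" "y = z + A *\<^sub>v v" by (auto simp: lattice_cong_def)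
  have "A *\<^sub>v (v + u) = A *\<^sub>v v + A *\<^sub>v u"
    using u v by (intro mult_add_distrib_mat_vec[of _ "dim_row A" "dim_col A"]) auto
  then have "x = z + A *\<^sub>v (v + u)" using u v assms(3) by (intro eq_vecI) auto
  then show ?thesis using u(1) v(1) unfolding lattice_cong_def by (intro bexI[of _ "v + u"]) auto
qed

text \<open>A bijection is stated, not an equality of cardinalities, so that finiteness also passes
  from one transversal to the other.\<close>

lemma transversal_card_eq:
  assumes "transversal A R" and "transversal A S"
  shows "\<exists>f. bij_betw f R S"
proof -
  define n where "n = dim_row A"
  let ?E = "lattice_cong A"
  have RS: "R \<subseteq> carrier_vec n" "S \<subseteq> carrier_vec n"
    and R: "\<And>x. x \<in> carrier_vec n \<Longrightarrow> \<exists>!y. y \<in> R \<and> ?E x y"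
    and S: "\<And>x. x \<in> carrier_vec n \<Longrightarrow> \<exists>!y. y \<in> S \<and> ?E x y"
    using assms unfolding transversal_def n_def by auto
  have sym: "?E y x" if "?E x y" "x \<in> carrier_vec n" "y \<in> carrier_vec n" for x y
    using that lattice_cong_sym unfolding n_def by blast
  define f where "f x = (THE y. y \<in> S \<and> ?E x y)" for x
  define g where "g x = (THE y. y \<in> R \<and> ?E x y)" for x
  have f: "f x \<in> S" "?E x (f x)" if "x \<in> carrier_vec n" for x
    using theI'[OF S[OF that]] unfolding f_def by auto
  have g: "g x \<in> R" "?E x (g x)" if "x \<in> carrier_vec n" for x
    using theI'[OF R[OF that]] unfolding g_def by auto
  have "bij_betw f R S"
  proof (rule bij_betw_byWitness[where f' = g])
    show "f ` R \<subseteq> S" "g ` S \<subseteq> R" using f g RS by auto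
    show "\<forall>x\<in>R. g (f x) = x"
    proof
      fix x assume x: "x \<in> R"
      then have xc: "x \<in> carrier_vec n" "f x \<in> carrier_vec n" using RS f by auto
      have "?E (f x) x" using sym f(2) xc by blast
      then show "g (f x) = x" using R[OF xc(2)] g[OF xc(2)] x by blast
    qed
    show "\<forall>x\<in>S. f (g x) = x"
    proof
      fix x assume x: "x \<in> S"
      then have xc: "x \<in> carrier_vec n" "g x \<in> carrier_vec n" using RS g by auto
      have "?E (g x) x" using sym g(2) xc by blast
      then show "f (g x) = x" using S[OF xc(2)] f[OF xc(2)] x by blast
    qed
  qed
  then show ?thesis by blast
qed

section \<open>Unimodular column operations, triangular form and the index of a lattice\<close>

lemma transversal_mult_invertible:
  assumes A: "A \<in> carrier_mat n m" and U: "U \<in> carrier_mat m m" and V: "V \<in> carrier_mat m m"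
    and UV: "U * V = 1\<^sub>m m" and R: "transversal (A * U) R"
  shows "transversal A R"
proof -
  \<comment> \<open>The columns of \<open>A * U\<close> and of \<open>A\<close> span the same
    lattice: a coefficient vector \<open>v\<close> for \<open>A\<close> becomes
    \<open>V *\<^sub>v v\<close> for \<open>A * U\<close>.\<close>
  have "(\<exists>v\<in>carrier_vec m. x = y + (A * U) *\<^sub>v v) \<longleftrightarrow> (\<exists>v\<in>carrier_vec m. x = y + A *\<^sub>v v)" for x y :: "int vec"
  proof safe
    fix v :: "int vec" assume v: "v \<in> carrier_vec m"
    show "\<exists>u\<in>carrier_vec m. y + (A * U) *\<^sub>v v = y + A *\<^sub>v u"
      using A U v by (intro bexI[of _ "U *\<^sub>v v"]) auto
    have "(A * U) *\<^sub>v (V *\<^sub>v v) = A *\<^sub>v ((U * V) *\<^sub>v v)"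
      using A U V v by (simp add: assoc_mult_mat_vec[of _ n m _ m] assoc_mult_mat_vec[of _ m m _ m])
    also have "\<dots> = A *\<^sub>v v" using UV v by simp
    finally show "\<exists>u\<in>carrier_vec m. y + A *\<^sub>v v = y + (A * U) *\<^sub>v u"
      using V v by (intro bexI[of _ "V *\<^sub>v v"]) auto
  qed
  then show ?thesis using R A U by (simp add: transversal_def lattice_cong_def)
qed

text \<open>Only the first column of \<open>T\<close> affects the first coordinate, which is
  therefore determined modulo \<open>g\<close>. Reducing it to its remainder fixes the coefficient
  \<open>q\<close> of that column; what is left of the vector is translated by \<open>q\<close>
  times \<open>c\<close> and then reduced modulo \<open>A\<close>.\<close>

lemma transversal_lower_block:
  assumes A: "A \<in> carrier_mat n n" and c: "c \<in> carrier_mat n 1" and g: "g \<noteq> 0"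
    and R: "transversal A R"
  defines "T \<equiv> four_block_mat (mat 1 1 (\<lambda>_. g)) (0\<^sub>m 1 n) c A"
  shows "transversal T ((\<lambda>(i, y). vec 1 (\<lambda>_. i) @\<^sub>v y) ` ({0..<\<bar>g\<bar>} \<times> R))"
proof -
  let ?s = "\<lambda>i::int. vec 1 (\<lambda>_. i)"
  let ?p = "\<lambda>i y. ?s i @\<^sub>v y"
  have G: "mat 1 1 (\<lambda>_. g) \<in> carrier_mat 1 1" by auto
  have dimT: "dim_row T = 1 + n" "dim_col T = 1 + n" unfolding T_def using A by auto
  have Rc: "R \<subseteq> carrier_vec n" using R A by (auto simp: transversal_def lattice_cong_def)
  have pc: "?p i y \<in> carrier_vec (1 + n)" if "y \<in> carrier_vec n" for i y
    using that by (intro append_carrier_vec) auto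
  have split: "\<exists>i y. x = ?p i y \<and> y \<in> carrier_vec n" if "x \<in> carrier_vec (1 + n)" for x
  proof -
    have "x = vec_first x 1 @\<^sub>v vec_last x n" using that by simp
    moreover have "vec_first x 1 = ?s (x $ 0)" unfolding vec_first_def by (rule eq_vecI) auto
    ultimately show ?thesis by (metis vec_last_carrier)
  qed
  have T: "?p j y + T *\<^sub>v (?p q v) = ?p (j + g * q) ((y + c *\<^sub>v ?s q) + A *\<^sub>v v)"
    if "v \<in> carrier_vec n" "y \<in> carrier_vec n" for j q y v
  proof -
    have "T *\<^sub>v (?p q v) =
        ((mat 1 1 (\<lambda>_. g) *\<^sub>v ?s q + 0\<^sub>m 1 n *\<^sub>v v) @\<^sub>v (c *\<^sub>v ?s q + A *\<^sub>v v))"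
      unfolding T_def by (rule four_block_mat_mult_vec[OF G _ c A]) (use that in auto)
    also have "mat 1 1 (\<lambda>_. g) *\<^sub>v ?s q + 0\<^sub>m 1 n *\<^sub>v v = ?s (g * q)"
      using that by (intro eq_vecI) (auto simp: scalar_prod_def)
    finally have "?p j y + T *\<^sub>v (?p q v) = ((?s j + ?s (g * q)) @\<^sub>v (y + (c *\<^sub>v ?s q + A *\<^sub>v v)))"
      using that A c by (simp add: append_vec_add[of _ 1 _ _ n])
    also have "?s j + ?s (g * q) = ?s (j + g * q)" by (intro eq_vecI) auto
    also have "y + (c *\<^sub>v ?s q + A *\<^sub>v v) = (y + c *\<^sub>v ?s q) + A *\<^sub>v v"
      using that A c by (intro eq_vecI) auto
    finally show ?thesis .
  qed
  have rep: "(\<exists>v\<in>carrier_vec (1 + n). ?p i x = ?p j y + T *\<^sub>v v) \<longleftrightarrow>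
      (\<exists>q. i = j + g * q \<and> (\<exists>v\<in>carrier_vec n. x - c *\<^sub>v ?s q = y + A *\<^sub>v v))"
    if y: "y \<in> carrier_vec n" and x: "x \<in> carrier_vec n" for i j x y
  proof -
    have *: "x - c *\<^sub>v ?s q = y + A *\<^sub>v v \<longleftrightarrow> x = (y + c *\<^sub>v ?s q) + A *\<^sub>v v" if "v \<in> carrier_vec n" for q v
      using that x y A c by (auto simp: vec_eq_iff)
    have **: "?s i = ?s j \<longleftrightarrow> i = j" for i j by (auto simp: vec_eq_iff)
    show ?thesis
    proof
      assume "\<exists>v\<in>carrier_vec (1 + n). ?p i x = ?p j y + T *\<^sub>v v"
      then obtain v where v: "v \<in> carrier_vec (1 + n)" "?p i x = ?p j y + T *\<^sub>v v" by auto
      from split[OF v(1)] obtain q u where u: "v = ?p q u" "u \<in> carrier_vec n" by auto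
      show "\<exists>q. i = j + g * q \<and> (\<exists>v\<in>carrier_vec n. x - c *\<^sub>v ?s q = y + A *\<^sub>v v)"
        using v(2) u T[OF u(2) y] ** * by (auto simp: append_vec_eq[of _ 1])
    next
      assume "\<exists>q. i = j + g * q \<and> (\<exists>v\<in>carrier_vec n. x - c *\<^sub>v ?s q = y + A *\<^sub>v v)"
      then obtain q u where u: "i = j + g * q" "u \<in> carrier_vec n" "x - c *\<^sub>v ?s q = y + A *\<^sub>v u" by auto
      then show "\<exists>v\<in>carrier_vec (1 + n). ?p i x = ?p j y + T *\<^sub>v v"
        using T[OF u(2) y, of j q] *[OF u(2)] by (intro bexI[of _ "?p q u"] pc) auto
    qed
  qed
  have "\<exists>!z. z \<in> (\<lambda>(i, y). ?p i y) ` ({0..<\<bar>g\<bar>} \<times> R) \<and> (\<exists>v\<in>carrier_vec (1 + n). x = z + T *\<^sub>v v)"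
    if x: "x \<in> carrier_vec (1 + n)" for x
  proof -
    from split[OF x] obtain i x' where x': "x = ?p i x'" "x' \<in> carrier_vec n" by auto
    \<comment> \<open>As \<open>g\<close> may be negative, the division is by
      \<open>\<bar>g\<bar>\<close> and the sign moves into the coefficient.\<close>
    have div: "j = i mod \<bar>g\<bar> \<and> q = sgn g * (i div \<bar>g\<bar>)"
      if "j \<in> {0..<\<bar>g\<bar>}" "i = j + g * q" for j q
    proof -
      have i: "i = j + \<bar>g\<bar> * (sgn g * q)"
        by (simp only: that(2) mult.assoc[symmetric] abs_mult_sgn)
      have j: "j mod \<bar>g\<bar> = j" "j div \<bar>g\<bar> = 0" using that(1) by auto
      have "sgn g * (sgn g * q) = q" using g by (cases "g > 0") auto
      moreover have "i mod \<bar>g\<bar> = j" unfolding i by (simp only: mod_mult_self2 j)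
      moreover have "i div \<bar>g\<bar> = sgn g * q"
        unfolding i by (subst div_mult_self2) (use g j in auto)
      ultimately show ?thesis by simp
    qed
    define q where "q = sgn g * (i div \<bar>g\<bar>)"
    have "g * q = \<bar>g\<bar> * (i div \<bar>g\<bar>)"
      unfolding q_def by (simp only: mult.assoc[symmetric] abs_sgn)
    then have q: "i mod \<bar>g\<bar> \<in> {0..<\<bar>g\<bar>}" "i = i mod \<bar>g\<bar> + g * q"
      using g by (simp, simp only: mod_mult_div_eq)
    have "x' - c *\<^sub>v ?s q \<in> carrier_vec n" using x' c by auto
    then obtain y where y: "y \<in> R" "\<exists>v\<in>carrier_vec n. x' - c *\<^sub>v ?s q = y + A *\<^sub>v v"
      and uniq: "\<And>z. z \<in> R \<Longrightarrow> \<exists>v\<in>carrier_vec n. x' - c *\<^sub>v ?s q = z + A *\<^sub>v v \<Longrightarrow> z = y"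
      using R A unfolding transversal_def lattice_cong_def by (metis carrier_matD)
    show ?thesis
    proof (rule ex1I[of _ "?p (i mod \<bar>g\<bar>) y"])
      have "\<exists>v\<in>carrier_vec (1 + n). x = ?p (i mod \<bar>g\<bar>) y + T *\<^sub>v v"
        unfolding x'(1)
      proof (rule iffD2[OF rep])
        show "y \<in> carrier_vec n" "x' \<in> carrier_vec n" using y(1) Rc x'(2) by auto
        show "\<exists>q. i = i mod \<bar>g\<bar> + g * q \<and> (\<exists>v\<in>carrier_vec n. x' - c *\<^sub>v ?s q = y + A *\<^sub>v v)"
          using q(2) y(2) by (intro exI[of _ q] conjI)
      qed
      then show "?p (i mod \<bar>g\<bar>) y \<in> (\<lambda>(i, y). ?p i y) ` ({0..<\<bar>g\<bar>} \<times> R) \<and>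
          (\<exists>v\<in>carrier_vec (1 + n). x = ?p (i mod \<bar>g\<bar>) y + T *\<^sub>v v)"
        using q(1) y(1) by (intro conjI image_eqI[of _ _ "(i mod \<bar>g\<bar>, y)"]) auto
    next
      fix z assume z: "z \<in> (\<lambda>(i, y). ?p i y) ` ({0..<\<bar>g\<bar>} \<times> R) \<and>
          (\<exists>v\<in>carrier_vec (1 + n). x = z + T *\<^sub>v v)"
      then obtain j y' where j: "j \<in> {0..<\<bar>g\<bar>}" "y' \<in> R" "z = ?p j y'" by auto
      with z have zv: "\<exists>v\<in>carrier_vec (1 + n). x = ?p j y' + T *\<^sub>v v" by simp
      have "\<exists>q'. i = j + g * q' \<and> (\<exists>v\<in>carrier_vec n. x' - c *\<^sub>v ?s q' = y' + A *\<^sub>v v)"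
      proof (rule iffD1[OF rep])
        show "y' \<in> carrier_vec n" "x' \<in> carrier_vec n" using j(2) Rc x'(2) by auto
        show "\<exists>v\<in>carrier_vec (1 + n). ?p i x' = ?p j y' + T *\<^sub>v v" using zv unfolding x'(1) .
      qed
      then obtain q' where q': "i = j + g * q'" "\<exists>v\<in>carrier_vec n. x' - c *\<^sub>v ?s q' = y' + A *\<^sub>v v" by blast
      have "j = i mod \<bar>g\<bar>" "q' = q" using div[OF j(1) q'(1)] by (simp_all only: q_def)
      moreover have "y' = y" using uniq[OF j(2)] q'(2) unfolding \<open>q' = q\<close> .
      ultimately show "z = ?p (i mod \<bar>g\<bar>) y" using j(3) by simp
    qed
  qed
  moreover have "(\<lambda>(i, y). ?p i y) ` ({0..<\<bar>g\<bar>} \<times> R) \<subseteq> carrier_vec (1 + n)"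
    using Rc pc by auto
  ultimately show ?thesis unfolding transversal_def lattice_cong_def dimT by blast
qed

text \<open>The Euclidean algorithm on the entries of the first row, carried out by column
  operations. The sum of their absolute values decreases in each step. The inverse \<open>V\<close>
  is carried along as a certificate of unimodularity.\<close>

lemma first_row_column_reduction:
  fixes A :: "int mat"
  assumes "A \<in> carrier_mat n n" and "0 < n"
  shows "\<exists>U\<in>carrier_mat n n. \<exists>V\<in>carrier_mat n n. U * V = 1\<^sub>m n \<and>
    (\<forall>j. 0 < j \<longrightarrow> j < n \<longrightarrow> (A * U) $$ (0, j) = 0)"
  using assms(1)
proof (induction "\<Sum>j<n. nat \<bar>A $$ (0, j)\<bar>" arbitrary: A rule: less_induct)
  case less
  note A = less.prems
  show ?case
  proof (cases "\<exists>j k. j < n \<and> k < n \<and> j \<noteq> k \<and> A $$ (0, j) \<noteq> 0 \<and> \<bar>A $$ (0, j)\<bar> \<le> \<bar>A $$ (0, k)\<bar>")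
    case True
    then obtain j k where jk: "j < n" "k < n" "j \<noteq> k" "A $$ (0, j) \<noteq> 0" "\<bar>A $$ (0, j)\<bar> \<le> \<bar>A $$ (0, k)\<bar>"
      by blast
    \<comment> \<open>Adding this multiple of column \<open>j\<close> to column \<open>k\<close>
      replaces the first entry of column \<open>k\<close> by its remainder modulo that of column
      \<open>j\<close>.\<close>
    define a where "a = - (A $$ (0, k) div A $$ (0, j))"
    define B where "B = A * addrow_mat n a j k"
    have B_eq: "B = addcol a k j A" unfolding B_def using addcol_mat[OF A jk(1)] by simp
    have B: "B \<in> carrier_mat n n" unfolding B_def using A by auto
    have Bj: "B $$ (0, i) = (if i = k then A $$ (0, k) mod A $$ (0, j) else A $$ (0, i))" if "i < n" for i
      using that A jk \<open>0 < n\<close> unfolding B_eq a_def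
      by (auto simp: minus_div_mult_eq_mod[symmetric])
    have "(\<Sum>i<n. nat \<bar>B $$ (0, i)\<bar>) < (\<Sum>i<n. nat \<bar>A $$ (0, i)\<bar>)"
    proof (rule sum_strict_mono_ex1)
      have "\<bar>A $$ (0, k) mod A $$ (0, j)\<bar> < \<bar>A $$ (0, k)\<bar>"
        using abs_mod_less[OF jk(4), of "A $$ (0, k)"] jk(5) by linarith
      then show "\<exists>i\<in>{..<n}. nat \<bar>B $$ (0, i)\<bar> < nat \<bar>A $$ (0, i)\<bar>"
        and "\<forall>i\<in>{..<n}. nat \<bar>B $$ (0, i)\<bar> \<le> nat \<bar>A $$ (0, i)\<bar>"
        using jk(2) by (auto simp: Bj intro!: bexI[of _ k])
    qed simp
    from less.hyps[OF this B] obtain U V where UV: "U \<in> carrier_mat n n" "V \<in> carrier_mat n n"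
      "U * V = 1\<^sub>m n" "\<forall>j. 0 < j \<longrightarrow> j < n \<longrightarrow> (B * U) $$ (0, j) = 0" by blast
    define E F where "E = addrow_mat n a j k" and "F = addrow_mat n (- a) j k"
    have EF: "E \<in> carrier_mat n n" "F \<in> carrier_mat n n" "E * F = 1\<^sub>m n"
      using addrow_mat_inv[OF jk(1-3)] by (auto simp: E_def F_def)
    have "(E * U) * (V * F) = E * ((U * V) * F)"
      using UV(1,2) EF(1,2) by (simp add: assoc_mult_mat[of _ n n _ n _ n])
    then have "(E * U) * (V * F) = 1\<^sub>m n" using UV(3) EF by simp
    moreover have "A * (E * U) = B * U"
      unfolding B_def E_def[symmetric] using A EF UV by (simp add: assoc_mult_mat[of _ n n _ n _ n])
    ultimately show ?thesis
      using UV EF by (intro bexI[of _ "E * U"] bexI[of _ "V * F"]) auto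
  next
    case False
    \<comment> \<open>Of two nonzero entries, the one of smaller absolute value could still reduce
      the other. Hence at most one entry is nonzero, and a swap brings its column to the
      front.\<close>
    have "\<exists>k<n. \<forall>j<n. j \<noteq> k \<longrightarrow> A $$ (0, j) = 0"
    proof (cases "\<exists>k<n. A $$ (0, k) \<noteq> 0")
      case True
      then obtain k where k: "k < n" "A $$ (0, k) \<noteq> 0" by blast
      have "A $$ (0, j) = 0" if "j < n" "j \<noteq> k" for j
        using False that k linorder_linear[of "\<bar>A $$ (0, j)\<bar>" "\<bar>A $$ (0, k)\<bar>"] by blast
      then show ?thesis using k by blast
    qed (use \<open>0 < n\<close> in auto)
    then obtain k where k: "k < n" "\<And>j. j < n \<Longrightarrow> j \<noteq> k \<Longrightarrow> A $$ (0, j) = 0" by blast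
    have "(A * swaprows_mat n 0 k) $$ (0, j) = 0" if "0 < j" "j < n" for j
      using swapcols_mat[OF A \<open>0 < n\<close> k(1), symmetric] that k A by auto
    then show ?thesis
      using swaprows_mat_inv[OF \<open>0 < n\<close> k(1)]
      by (intro bexI[of _ "swaprows_mat n 0 k"]) auto
  qed
qed

text \<open>Induction on the dimension: once the first row is cleared, the corner entry
  \<open>g\<close> contributes a factor \<open>\<bar>g\<bar>\<close> and the remaining block
  contributes its own absolute determinant.\<close>

lemma exists_transversal:
  assumes "A \<in> carrier_mat n n" and "det A \<noteq> 0"
  shows "\<exists>R. transversal A R \<and> finite R \<and> card R = nat \<bar>det A\<bar>"
  using assms
proof (induction n arbitrary: A)
  case 0
  have "transversal A {0\<^sub>v 0}"
    using 0 unfolding transversal_def lattice_cong_def by (auto intro!: bexI[of _ "0\<^sub>v 0"] eq_vecI)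
  moreover have "det A = 1" using 0 by (simp add: det_dim_zero)
  ultimately show ?case by (intro exI[of _ "{0\<^sub>v 0}"]) simp
next
  case (Suc n)
  note A = Suc.prems(1)
  from first_row_column_reduction[OF A] obtain U V where U: "U \<in> carrier_mat (Suc n) (Suc n)"
    and V: "V \<in> carrier_mat (Suc n) (Suc n)" and UV: "U * V = 1\<^sub>m (Suc n)"
    and row: "\<And>j. 0 < j \<Longrightarrow> j < Suc n \<Longrightarrow> (A * U) $$ (0, j) = 0"
    by blast
  define T where "T = A * U"
  have T: "T \<in> carrier_mat (Suc n) (Suc n)" unfolding T_def using A U by auto
  define g where "g = T $$ (0, 0)"
  define c where "c = mat n 1 (\<lambda>(i, j). T $$ (Suc i, 0))"
  define B where "B = mat n n (\<lambda>(i, j). T $$ (Suc i, Suc j))"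
  have c: "c \<in> carrier_mat n 1" and B: "B \<in> carrier_mat n n" by (auto simp: c_def B_def)
  have T_eq: "T = four_block_mat (mat 1 1 (\<lambda>_. g)) (0\<^sub>m 1 n) c B"
  proof (rule eq_matI)
    fix i j assume "i < dim_row (four_block_mat (mat 1 1 (\<lambda>_. g)) (0\<^sub>m 1 n) c B)"
      "j < dim_col (four_block_mat (mat 1 1 (\<lambda>_. g)) (0\<^sub>m 1 n) c B)"
    then have "i < Suc n" "j < Suc n" using B by auto
    then show "T $$ (i, j) = four_block_mat (mat 1 1 (\<lambda>_. g)) (0\<^sub>m 1 n) c B $$ (i, j)"
      using B c row[of j] by (auto simp: g_def c_def B_def T_def[symmetric])
  qed (use T B in auto)
  \<comment> \<open>An integer factor of 1 is a unit, so the column operations preserve the absolute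
    determinant.\<close>
  have "det U * det V = 1"
    using det_mult[OF U V] UV by simp
  then have detU: "\<bar>det U\<bar> = 1" using abs_zmult_eq_1[of "det U" "det V"] by simp
  have detT: "\<bar>det T\<bar> = \<bar>det A\<bar>"
    unfolding T_def using det_mult[OF A U] detU by (simp add: abs_mult)
  have "det T = det (mat 1 1 (\<lambda>_. g)) * det B"
    unfolding T_eq by (rule det_four_block_mat_upper_right_zero[OF _ refl c B]) auto
  also have "det (mat 1 1 (\<lambda>_. g)) = g" by (simp add: det_single)
  finally have detB: "det T = g * det B" .
  then have "det B \<noteq> 0" and g: "g \<noteq> 0" using detT Suc.prems(2) by auto
  from Suc.IH[OF B this(1)] obtain R where R: "transversal B R" "finite R" "card R = nat \<bar>det B\<bar>" by blast
  let ?S = "(\<lambda>(i, y). vec 1 (\<lambda>_. i) @\<^sub>v y) ` ({0..<\<bar>g\<bar>} \<times> R)"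
  have "transversal T ?S" unfolding T_eq by (rule transversal_lower_block[OF B c g R(1)])
  then have S: "transversal A ?S"
    unfolding T_def by (rule transversal_mult_invertible[OF A U V UV])
  have "inj_on (\<lambda>(i, y). vec 1 (\<lambda>_. i) @\<^sub>v y) ({0..<\<bar>g\<bar>} \<times> R)"
  proof (rule inj_onI, clarify)
    fix i j y z assume "vec 1 (\<lambda>_. i) @\<^sub>v y = vec 1 (\<lambda>_. j) @\<^sub>v z"
    then have *: "vec 1 (\<lambda>_. i) = vec 1 (\<lambda>_. j)" "y = z"
      by (simp_all only: append_vec_eq[OF vec_carrier vec_carrier])
    have "vec 1 (\<lambda>_. i) $ 0 = vec 1 (\<lambda>_. j) $ 0" using *(1) by (simp only:)
    then show "i = j \<and> y = z" using *(2) by simp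
  qed
  moreover have "nat \<bar>g\<bar> * nat \<bar>det B\<bar> = nat \<bar>det A\<bar>"
    using detB detT by (metis abs_ge_zero abs_mult nat_mult_distrib)
  ultimately have "card ?S = nat \<bar>det A\<bar>"
    using R(3) by (simp only: card_image card_cartesian_product card_atLeastLessThan_int diff_zero)
  with S R(2) show ?case by (intro exI[of _ ?S]) simp
qed

lemma card_transversal:
  assumes "A \<in> carrier_mat n n" and "det A \<noteq> 0" and "transversal A R"
  shows "finite R" and "card R = nat \<bar>det A\<bar>"
proof -
  from exists_transversal[OF assms(1,2)] obtain S
    where S: "transversal A S" "finite S" "card S = nat \<bar>det A\<bar>" by blast
  from transversal_card_eq[OF assms(3) S(1)] obtain f where "bij_betw f R S" by blast
  then show "finite R" "card R = nat \<bar>det A\<bar>"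
    using S bij_betw_finite[of f R S] bij_betw_same_card[of f R S] by simp_all
qed

text \<open>Pigeonhole: sending each point of \<open>T\<close> to its representative in a known
  transversal of the same finite size is injective, hence onto. This is the source of existence in
  every class.\<close>

lemma transversalI_card:
  assumes A: "A \<in> carrier_mat n n" and det: "det A \<noteq> 0" and T: "T \<subseteq> carrier_vec n"
    and fin: "finite T" and card: "card T = nat \<bar>det A\<bar>"
    and inj: "\<And>x y. x \<in> T \<Longrightarrow> y \<in> T \<Longrightarrow> lattice_cong A x y \<Longrightarrow> x = y"
  shows "transversal A T"
proof -
  from exists_transversal[OF A det] obtain S
    where S: "transversal A S" "finite S" "card S = nat \<bar>det A\<bar>" by blast
  have Sc: "S \<subseteq> carrier_vec n" and S_ex: "\<And>x. x \<in> carrier_vec n \<Longrightarrow> \<exists>!y. y \<in> S \<and> lattice_cong A x y"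
    using S(1) A unfolding transversal_def by auto
  define f where "f x = (THE y. y \<in> S \<and> lattice_cong A x y)" for x
  have f: "f x \<in> S" "lattice_cong A x (f x)" if "x \<in> carrier_vec n" for x
    using theI'[OF S_ex[OF that]] unfolding f_def by auto
  have cong: "lattice_cong A y x" if "lattice_cong A x z" "lattice_cong A y z"
    "x \<in> carrier_vec n" "z \<in> carrier_vec n" for x y z
    using that lattice_cong_sym[of A x z] lattice_cong_trans[of A y z x] A by auto
  have "inj_on f T"
  proof (rule inj_onI)
    fix x y assume xy: "x \<in> T" "y \<in> T" "f x = f y"
    then have c: "x \<in> carrier_vec n" "y \<in> carrier_vec n" using T by auto
    have "f x \<in> carrier_vec n" using f(1)[OF c(1)] Sc by blast
    then have "lattice_cong A x y" using cong[of y "f x" x] f(2)[OF c(1)] f(2)[OF c(2)] c xy(3) by simp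
    then show "x = y" using inj xy by blast
  qed
  then have "card (f ` T) = card S" using card S(3) by (simp add: card_image)
  moreover have "f ` T \<subseteq> S" using f T by auto
  ultimately have surj: "f ` T = S" using S(2) by (intro card_subset_eq)
  have "\<exists>!y. y \<in> T \<and> lattice_cong A x y" if x: "x \<in> carrier_vec n" for x
  proof -
    from f(1)[OF x] surj obtain t where t: "t \<in> T" "f x = f t" by auto
    have tc: "t \<in> carrier_vec n" using t T by auto
    have "lattice_cong A x t" using cong[of t "f x" x] f[OF x] f(2)[OF tc] t tc Sc by auto
    moreover have "y = t" if "y \<in> T" "lattice_cong A x y" for y
    proof -
      have "lattice_cong A y x" using that(2) lattice_cong_sym that(1) T A by blast
      then have "lattice_cong A y t" using lattice_cong_trans \<open>lattice_cong A x t\<close> tc A by blast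
      then show ?thesis using inj that(1) t(1) by blast
    qed
    ultimately show ?thesis using t(1) by blast
  qed
  then show ?thesis unfolding transversal_def using T A by auto
qed

section \<open>Determinants of the cells\<close>

text \<open>Its columns are the edge vectors of the cell of \<open>B\<close>, so its column lattice
  is the edge lattice.\<close>

definition cell_mat :: "int mat \<Rightarrow> nat set \<Rightarrow> int mat" where
  "cell_mat M B = four_block_mat (submatrix (std_rep_mat M) UNIV B) (0\<^sub>m (row_num M) (dim_col M))
     (0\<^sub>m (dim_col M) (row_num M)) (submatrix (dual_rep_mat M) UNIV ({0..<ground_size M} - B))"

text \<open>Lists \<open>B\<close> increasingly and then its complement. The last branch is the
  identity, as \<open>permutes\<close> demands outside the ground set.\<close>

definition basis_enum :: "int mat \<Rightarrow> nat set \<Rightarrow> nat \<Rightarrow> nat" where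
  "basis_enum M B k = (if k < row_num M then pick B k
     else if k < ground_size M then pick ({0..<ground_size M} - B) (k - row_num M) else k)"

text \<open>One term of the multilinear expansion of the full matrix: each column is the sum of its
  upper and its lower part, and the upper part is kept exactly for the columns in \<open>B\<close>.
  When \<open>B\<close> has \<open>row_num M\<close> elements, this is \<open>cell_mat\<close> with
  its columns in the original order.\<close>

definition split_mat :: "int mat \<Rightarrow> nat set \<Rightarrow> int mat" where
  "split_mat M B = mat (ground_size M) (ground_size M)
     (\<lambda>(i, j). if i < row_num M \<longleftrightarrow> j \<in> B then full_rep_mat M $$ (i, j) else 0)"

lemma std_rep_mat_carrier [simp]: "std_rep_mat M \<in> carrier_mat (row_num M) (ground_size M)"
  and dual_rep_mat_carrier [simp]: "dual_rep_mat M \<in> carrier_mat (dim_col M) (ground_size M)"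
  and full_rep_mat_carrier [simp]: "full_rep_mat M \<in> carrier_mat (ground_size M) (ground_size M)"
  by (auto simp: std_rep_mat_def dual_rep_mat_def full_rep_mat_def append_cols_def row_num_def ground_size_def)

lemma dim_rep_mat [simp]:
  "dim_row (std_rep_mat M) = row_num M" "dim_col (std_rep_mat M) = ground_size M"
  "dim_row (dual_rep_mat M) = dim_col M" "dim_col (dual_rep_mat M) = ground_size M"
  "dim_row (full_rep_mat M) = ground_size M" "dim_col (full_rep_mat M) = ground_size M"
  using std_rep_mat_carrier[of M] dual_rep_mat_carrier[of M] full_rep_mat_carrier[of M] by blast+

lemma std_rep_mat_index:
  "i < row_num M \<Longrightarrow> j < ground_size M \<Longrightarrow> std_rep_mat M $$ (i, j) =
    (if j < row_num M then (if i = j then 1 else 0) else M $$ (i, j - row_num M))"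
  by (auto simp: std_rep_mat_def append_cols_def row_num_def ground_size_def)

lemma dual_rep_mat_index:
  "i < dim_col M \<Longrightarrow> j < ground_size M \<Longrightarrow> dual_rep_mat M $$ (i, j) =
    (if j < row_num M then - M $$ (j, i) else (if i = j - row_num M then 1 else 0))"
  by (auto simp: dual_rep_mat_def append_cols_def row_num_def ground_size_def)

lemma full_rep_mat_index:
  "i < ground_size M \<Longrightarrow> j < ground_size M \<Longrightarrow> full_rep_mat M $$ (i, j) =
    (if i < row_num M then std_rep_mat M $$ (i, j) else dual_rep_mat M $$ (i - row_num M, j))"
  using std_rep_mat_index[of i M j] dual_rep_mat_index[of "i - row_num M" M j]
  by (auto simp: full_rep_mat_def row_num_def ground_size_def)

lemma det_permute_cols:
  assumes A: "A \<in> carrier_mat n n" and p: "p permutes {0..<n}"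
  shows "det (mat n n (\<lambda>(i, j). A $$ (i, p j))) = signof p * det A"
proof -
  have p_lt: "p i < n" if "i < n" for i
    using permutes_in_image[OF p, of i] that by simp
  have "det (mat n n (\<lambda>(i, j). A $$ (i, p j))) = det (mat n n (\<lambda>(i, j). A $$ (i, p j)))\<^sup>T"
    by (rule det_transpose[symmetric]) auto
  also have "(mat n n (\<lambda>(i, j). A $$ (i, p j)))\<^sup>T = mat n n (\<lambda>(i, j). A\<^sup>T $$ (p i, j))"
    using A p_lt by (intro eq_matI) auto
  also have "det \<dots> = signof p * det A\<^sup>T"
    using A by (intro det_permute_rows p) auto
  finally show ?thesis using det_transpose[OF A] by simp
qed

section \<open>The blocks of \<open>D\<close> and of the dual matrix on complementary column
  sets\<close>

context
  fixes M :: "int mat" and B :: "nat set"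
  assumes B: "B \<subseteq> {0..<ground_size M}" "card B = row_num M"
begin

lemma finite_column_set: "finite B" using B(1) finite_subset by blast

lemma card_complement_columns: "card ({0..<ground_size M} - B) = dim_col M"
  using B by (simp add: card_Diff_subset finite_column_set ground_size_def row_num_def)

lemma basis_enum_in_B: "k < row_num M \<Longrightarrow> basis_enum M B k \<in> B"
  unfolding basis_enum_def using pick_in_set_le[of k B] B(2) by simp

lemma basis_enum_notin_B:
  "row_num M \<le> k \<Longrightarrow> k < ground_size M \<Longrightarrow> basis_enum M B k \<in> {0..<ground_size M} - B"
  unfolding basis_enum_def using pick_in_set_le[of "k - row_num M" "{0..<ground_size M} - B"]
  by (simp add: card_complement_columns) (auto simp: ground_size_def row_num_def)

lemma basis_enum_permutes: "basis_enum M B permutes {0..<ground_size M}"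
proof -
  let ?C = "{0..<ground_size M} - B"
  have lt: "basis_enum M B k < ground_size M" if "k < ground_size M" for k
    using that basis_enum_in_B[of k] basis_enum_notin_B[of k] B(1) by (cases "k < row_num M") auto
  have inj: "inj_on (basis_enum M B) {0..<ground_size M}"
  proof (rule inj_onI)
    fix k l assume kl: "k \<in> {0..<ground_size M}" "l \<in> {0..<ground_size M}" "basis_enum M B k = basis_enum M B l"
    have gs: "ground_size M = row_num M + dim_col M" by (simp add: ground_size_def row_num_def)
    have same: "k < row_num M \<longleftrightarrow> l < row_num M"
      using kl basis_enum_in_B[of k] basis_enum_notin_B[of k] basis_enum_in_B[of l] basis_enum_notin_B[of l]
      by (metis DiffD2 atLeastLessThan_iff not_le)
    show "k = l"
    proof (cases "k < row_num M")
      case True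
      then have "pick B k = pick B l" using kl same by (simp add: basis_enum_def)
      then show ?thesis using True same B(2) pick_mono_le by (metis nat_neq_iff)
    next
      case False
      then have "pick ?C (k - row_num M) = pick ?C (l - row_num M)"
        using kl same by (simp add: basis_enum_def)
      moreover have "k - row_num M < card ?C" "l - row_num M < card ?C"
        unfolding card_complement_columns using False same kl by (auto simp: gs)
      ultimately have "k - row_num M = l - row_num M" using pick_mono_le by (metis nat_neq_iff)
      then show ?thesis using False same by simp
    qed
  qed
  have "basis_enum M B ` {0..<ground_size M} = {0..<ground_size M}"
    using lt by (intro endo_inj_surj inj) auto
  then show ?thesis
    using inj by (intro bij_imp_permutes) (auto simp: bij_betw_def basis_enum_def ground_size_def row_num_def)
qed

lemma submatrix_std_rep_carrier: "submatrix (std_rep_mat M) UNIV B \<in> carrier_mat (row_num M) (row_num M)"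
proof -
  have "{j. j < dim_col (std_rep_mat M) \<and> j \<in> B} = B" using B(1) by auto
  then show ?thesis by (intro carrier_matI) (simp_all only: dim_submatrix B(2), simp_all)
qed

lemma submatrix_dual_rep_carrier:
  "submatrix (dual_rep_mat M) UNIV ({0..<ground_size M} - B) \<in> carrier_mat (dim_col M) (dim_col M)"
proof -
  have "{j. j < dim_col (dual_rep_mat M) \<and> j \<in> {0..<ground_size M} - B} = {0..<ground_size M} - B" by auto
  then show ?thesis by (intro carrier_matI) (simp_all only: dim_submatrix card_complement_columns, simp_all)
qed

lemma submatrix_std_rep_index:
  assumes "i < row_num M" "k < row_num M"
  shows "submatrix (std_rep_mat M) UNIV B $$ (i, k) = std_rep_mat M $$ (i, basis_enum M B k)"
  using carrier_matD[OF submatrix_std_rep_carrier, unfolded dim_submatrix] assms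
  by (subst submatrix_index) (simp_all only: pick_UNIV basis_enum_def if_True)

lemma submatrix_dual_rep_index:
  assumes "i < dim_col M" "k < dim_col M"
  shows "submatrix (dual_rep_mat M) UNIV ({0..<ground_size M} - B) $$ (i, k) =
    dual_rep_mat M $$ (i, basis_enum M B (row_num M + k))"
  using carrier_matD[OF submatrix_dual_rep_carrier, unfolded dim_submatrix] assms
  by (subst submatrix_index)
    (simp_all only: pick_UNIV, simp add: basis_enum_def ground_size_def row_num_def)

lemma cell_mat_carrier: "cell_mat M B \<in> carrier_mat (ground_size M) (ground_size M)"
proof -
  have "ground_size M = row_num M + dim_col M" by (simp add: ground_size_def row_num_def)
  then show ?thesis unfolding cell_mat_def
    using four_block_carrier_mat[OF submatrix_std_rep_carrier submatrix_dual_rep_carrier] by simp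
qed

lemma cell_mat_index:
  assumes "i < ground_size M" "k < ground_size M"
  shows "cell_mat M B $$ (i, k) =
    (if i < row_num M \<longleftrightarrow> k < row_num M then full_rep_mat M $$ (i, basis_enum M B k) else 0)"
proof -
  have gs: "ground_size M = row_num M + dim_col M" by (simp add: ground_size_def row_num_def)
  have "basis_enum M B k < ground_size M"
    using permutes_in_image[OF basis_enum_permutes, of k] assms by simp
  then show ?thesis
    using assms carrier_matD[OF submatrix_std_rep_carrier] carrier_matD[OF submatrix_dual_rep_carrier]
      submatrix_std_rep_index[of i k] submatrix_dual_rep_index[of "i - row_num M" "k - row_num M"]
    unfolding cell_mat_def by (auto simp: full_rep_mat_index gs)
qed

lemma cell_mat_eq_split_mat:
  "cell_mat M B = mat (ground_size M) (ground_size M) (\<lambda>(i, k). split_mat M B $$ (i, basis_enum M B k))"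
proof (rule eq_matI)
  fix i k assume "i < dim_row (mat (ground_size M) (ground_size M) (\<lambda>(i, k). split_mat M B $$ (i, basis_enum M B k)))"
    "k < dim_col (mat (ground_size M) (ground_size M) (\<lambda>(i, k). split_mat M B $$ (i, basis_enum M B k)))"
  then have ik: "i < ground_size M" "k < ground_size M" by auto
  then have "basis_enum M B k < ground_size M"
    using permutes_in_image[OF basis_enum_permutes, of k] by simp
  moreover have "basis_enum M B k \<in> B \<longleftrightarrow> k < row_num M"
    using ik basis_enum_in_B[of k] basis_enum_notin_B[of k] by (cases "k < row_num M") auto
  ultimately show "cell_mat M B $$ (i, k) =
      mat (ground_size M) (ground_size M) (\<lambda>(i, k). split_mat M B $$ (i, basis_enum M B k)) $$ (i, k)"
    using ik by (simp add: cell_mat_index split_mat_def)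
qed (use cell_mat_carrier in auto)

lemma det_cell_mat_split_mat:
  "det (cell_mat M B) = signof (basis_enum M B) * det (split_mat M B)"
  unfolding cell_mat_eq_split_mat
  by (rule det_permute_cols[OF _ basis_enum_permutes]) (auto simp: split_mat_def)

text \<open>Complementary minors of matrices with orthogonal row spaces agree up to sign. The exact
  sign matters, because it has to cancel against the reordering of columns in
  \<open>det_cell_mat_split_mat\<close>.\<close>

lemma det_submatrix_dual_rep:
  "det (submatrix (dual_rep_mat M) UNIV ({0..<ground_size M} - B)) =
    signof (basis_enum M B) * basis_det M B"
proof -
  let ?r = "row_num M" and ?m = "dim_col M" and ?n = "ground_size M" and ?s = "basis_enum M B"
  let ?Dh = "submatrix (dual_rep_mat M) UNIV ({0..<?n} - B)"
  have gs: "?n = ?r + ?m" by (simp add: ground_size_def row_num_def)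
  have dM: "dim_row M = ?r" by (simp add: row_num_def)
  then have M: "M \<in> carrier_mat ?r ?m" and mM: "- M \<in> carrier_mat ?r ?m"
    by (intro carrier_matI; simp)+
  have s_lt: "?s k < ?n" if "k < ?n" for k
    using permutes_in_image[OF basis_enum_permutes, of k] that by simp
  have s_eq: "?s i = ?s j \<longleftrightarrow> i = j" for i j
    using permutes_inj[OF basis_enum_permutes] by (auto dest: injD)
  \<comment> \<open>\<open>N\<close> stacks \<open>D\<close> on the unit rows indexed by the complement of \<open>B\<close>. Permuting its columns
    exposes the block of \<open>D\<close> on \<open>B\<close>; multiplying it by the unimodular \<open>X\<close>, whose last columns
    span the kernel of \<open>D\<close>, exposes the complementary block of the dual matrix.\<close>
  define N3 where "N3 = mat ?m ?r (\<lambda>(i, j). if j = ?s (?r + i) then 1 else 0 :: int)"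
  define N4 where "N4 = mat ?m ?m (\<lambda>(i, j). if ?r + j = ?s (?r + i) then 1 else 0 :: int)"
  define N where "N = four_block_mat (1\<^sub>m ?r) M N3 N4"
  define X where "X = four_block_mat (1\<^sub>m ?r) (- M) (0\<^sub>m ?m ?r) (1\<^sub>m ?m)"
  define C where "C = mat ?r ?m (\<lambda>(i, j). std_rep_mat M $$ (i, ?s (?r + j)))"
  have c: "N3 \<in> carrier_mat ?m ?r" "N4 \<in> carrier_mat ?m ?m" "C \<in> carrier_mat ?r ?m"
    by (auto simp: N3_def N4_def C_def)
  have N: "N \<in> carrier_mat ?n ?n" and X: "X \<in> carrier_mat ?n ?n"
    using c by (auto simp: N_def X_def gs dM)
  have "mat ?n ?n (\<lambda>(i, j). N $$ (i, ?s j)) =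
      four_block_mat (submatrix (std_rep_mat M) UNIV B) C (0\<^sub>m ?m ?r) (1\<^sub>m ?m)" (is "?L = ?R")
  proof (rule eq_matI)
    fix i k assume "i < dim_row ?R" "k < dim_col ?R"
    then have ik: "i < ?n" "k < ?n" using submatrix_std_rep_carrier c by (auto simp: gs)
    have sk: "?s k < ?r + ?m" using s_lt[OF ik(2)] gs by simp
    show "?L $$ (i, k) = ?R $$ (i, k)"
    proof (cases "i < ?r")
      case True
      then have "?L $$ (i, k) = std_rep_mat M $$ (i, ?s k)"
        using ik sk c by (auto simp: N_def std_rep_mat_index gs dM)
      also have "\<dots> = ?R $$ (i, k)"
        using True ik c submatrix_std_rep_carrier by (auto simp: gs submatrix_std_rep_index C_def)
      finally show ?thesis .
    next
      case False
      then have "?L $$ (i, k) = (if ?s k = ?s i then 1 else 0)"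
        using ik sk c by (auto simp: N_def N3_def N4_def gs dM)
      also have "\<dots> = ?R $$ (i, k)"
        using False ik c submatrix_std_rep_carrier by (auto simp: gs s_eq)
      finally show ?thesis .
    qed
  qed (simp_all add: carrier_matD[OF submatrix_std_rep_carrier] gs)
  then have "signof ?s * det N = det ?R"
    using det_permute_cols[OF N basis_enum_permutes] by simp
  also have "\<dots> = basis_det M B * det (1\<^sub>m ?m :: int mat)"
    unfolding basis_det_def
    by (rule det_four_block_mat_lower_left_zero[OF submatrix_std_rep_carrier _ refl]) (use c in auto)
  finally have 1: "signof ?s * det N = basis_det M B" by simp
  have NX: "N * X = four_block_mat (1\<^sub>m ?r) (0\<^sub>m ?r ?m) N3 ?Dh\<^sup>T"
  proof -
    have "N * X = four_block_mat (1\<^sub>m ?r * 1\<^sub>m ?r + M * 0\<^sub>m ?m ?r) (1\<^sub>m ?r * (- M) + M * 1\<^sub>m ?m)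
        (N3 * 1\<^sub>m ?r + N4 * 0\<^sub>m ?m ?r) (N3 * (- M) + N4 * 1\<^sub>m ?m)"
      unfolding N_def X_def by (rule mult_four_block_mat) (use c in \<open>auto simp: dM\<close>)
    also have "1\<^sub>m ?r * 1\<^sub>m ?r + M * 0\<^sub>m ?m ?r = 1\<^sub>m ?r" using right_mult_zero_mat[OF M] by simp
    also have "1\<^sub>m ?r * (- M) + M * 1\<^sub>m ?m = 0\<^sub>m ?r ?m"
      unfolding left_mult_one_mat[OF mM] right_mult_one_mat[OF M] by (rule uminus_l_inv_mat[OF M])
    also have "N3 * 1\<^sub>m ?r + N4 * 0\<^sub>m ?m ?r = N3" using c by simp
    \<comment> \<open>The rows of \<open>(N3 N4)\<close> are the unit vectors at the complement of
      \<open>B\<close>. They select the corresponding rows of \<open>- M\<close> stacked on the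
      identity, which is the transpose of the dual matrix.\<close>
    also have "N3 * (- M) + N4 * 1\<^sub>m ?m = ?Dh\<^sup>T"
    proof (rule eq_matI)
      fix i j assume "i < dim_row ?Dh\<^sup>T" "j < dim_col ?Dh\<^sup>T"
      then have ij: "i < ?m" "j < ?m" using submatrix_dual_rep_carrier by auto
      have si: "?s (?r + i) < ?r + ?m" using s_lt[of "?r + i"] ij gs by simp
      have "(N3 * (- M)) $$ (i, j) = (\<Sum>k\<in>{0..<?r}. N3 $$ (i, k) * (- M) $$ (k, j))"
        using ij c dM by (simp add: scalar_prod_def sum_negf)
      also have "\<dots> = (\<Sum>k\<in>{0..<?r}. if k = ?s (?r + i) then - M $$ (k, j) else 0)"
        using ij dM by (intro sum.cong) (auto simp: N3_def)
      also have "\<dots> = (if ?s (?r + i) < ?r then - M $$ (?s (?r + i), j) else 0)" by simp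
      finally have "(N3 * (- M) + N4 * 1\<^sub>m ?m) $$ (i, j) =
          (if ?s (?r + i) < ?r then - M $$ (?s (?r + i), j) else 0) + N4 $$ (i, j)"
        using ij c by simp
      also have "\<dots> = dual_rep_mat M $$ (j, ?s (?r + i))"
        using ij si by (auto simp: N4_def dual_rep_mat_index gs)
      also have "\<dots> = ?Dh $$ (j, i)" using submatrix_dual_rep_index[OF ij(2,1)] by simp
      also have "\<dots> = ?Dh\<^sup>T $$ (i, j)"
        using ij carrier_matD[OF submatrix_dual_rep_carrier] by (simp only: index_transpose_mat)
      finally show "(N3 * (- M) + N4 * 1\<^sub>m ?m) $$ (i, j) = ?Dh\<^sup>T $$ (i, j)" .
    qed (simp_all add: carrier_matD[OF submatrix_dual_rep_carrier] carrier_matD[OF c(2)])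
    finally show ?thesis .
  qed
  have "det X = det (1\<^sub>m ?r :: int mat) * det (1\<^sub>m ?m :: int mat)"
    unfolding X_def by (rule det_four_block_mat_lower_left_zero) (auto simp: dM)
  then have "det N = det (N * X)" using det_mult[OF N X] by simp
  also have "\<dots> = det (1\<^sub>m ?r :: int mat) * det ?Dh\<^sup>T"
    unfolding NX by (rule det_four_block_mat_upper_right_zero) (use c submatrix_dual_rep_carrier in auto)
  also have "\<dots> = det ?Dh" using det_transpose[OF submatrix_dual_rep_carrier] by simp
  finally have 2: "det N = det ?Dh" .
  have "det N = signof ?s * (signof ?s * det N)" by (simp add: sign_def)
  then have "det N = signof ?s * basis_det M B" unfolding 1 .
  then show ?thesis using 2 by simp
qed

lemma det_cell_mat: "det (cell_mat M B) = signof (basis_enum M B) * (basis_det M B)\<^sup>2"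
proof -
  have "det (cell_mat M B) =
      basis_det M B * det (submatrix (dual_rep_mat M) UNIV ({0..<ground_size M} - B))"
    unfolding cell_mat_def basis_det_def
    by (rule det_four_block_mat_lower_left_zero[OF submatrix_std_rep_carrier _ _ submatrix_dual_rep_carrier]) auto
  then show ?thesis by (simp add: det_submatrix_dual_rep power2_eq_square)
qed

lemma abs_det_cell_mat: "nat \<bar>det (cell_mat M B)\<bar> = (basis_mult M B)\<^sup>2"
  by (simp add: det_cell_mat basis_mult_def sign_def nat_power_eq[symmetric])

text \<open>The sign from the complementary minor meets the sign of the same permutation from the
  reordering of columns, and both disappear.\<close>

lemma det_split_mat: "det (split_mat M B) = (basis_det M B)\<^sup>2"
  using det_cell_mat det_cell_mat_split_mat by (simp add: sign_def split: if_splits)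

end

section \<open>Expansion of the determinant of the full matrix over column sets\<close>

lemma det_split_mat_eq_0:
  assumes B: "B \<subseteq> {0..<ground_size M}" and card: "card B \<noteq> row_num M"
  shows "det (split_mat M B) = 0"
proof -
  let ?n = "ground_size M"
  have S: "split_mat M B \<in> carrier_mat ?n ?n" by (simp add: split_mat_def)
  have "(\<Prod>i = 0..<?n. (split_mat M B)\<^sup>T $$ (i, p i)) = 0" if p: "p permutes {0..<?n}" for p
  proof -
    \<comment> \<open>A permutation takes exactly \<open>row_num M\<close> columns to upper rows,
      whereas column \<open>i\<close> of \<open>split_mat M B\<close> is supported in the upper rows
      if \<open>i\<close> is in \<open>B\<close> and in the lower rows otherwise. If
      \<open>B\<close> has another size, some factor of each Leibniz product is zero.\<close>
    have "bij_betw p {i \<in> {0..<?n}. p i < row_num M} {0..<row_num M}"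
    proof (rule bij_betwI')
      show "\<exists>x\<in>{i \<in> {0..<?n}. p i < row_num M}. y = p x" if "y \<in> {0..<row_num M}" for y
      proof -
        have "y \<in> p ` {0..<?n}" using that permutes_image[OF p] by (auto simp: ground_size_def row_num_def)
        then show ?thesis using that by auto
      qed
    qed (simp_all add: inj_eq[OF permutes_inj[OF p]])
    then have "card {i \<in> {0..<?n}. p i < row_num M} = row_num M"
      by (simp only: bij_betw_same_card card_atLeastLessThan diff_zero)
    then have "{i \<in> {0..<?n}. p i < row_num M} \<noteq> B" using card by auto
    moreover have "{i \<in> {0..<?n}. p i < row_num M} = B" if "\<forall>i<?n. p i < row_num M \<longleftrightarrow> i \<in> B"
      using that subsetD[OF B] by fastforce
    ultimately obtain i where i: "i < ?n" "\<not> (p i < row_num M \<longleftrightarrow> i \<in> B)" by blast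
    then have "(split_mat M B)\<^sup>T $$ (i, p i) = 0"
      using permutes_in_image[OF p, of i] by (auto simp: split_mat_def)
    then show ?thesis using i(1) by (intro prod_zero) auto
  qed
  then have "det (split_mat M B)\<^sup>T = 0"
    using S by (subst det_def'[of _ ?n]) (auto intro!: sum.neutral)
  then show ?thesis using det_transpose[OF S] by simp
qed

text \<open>Multilinearity in the columns, obtained inside the Leibniz formula: it is written with
  one factor per column, and each factor is the sum of an upper and a lower contribution.\<close>

lemma det_full_rep_mat_eq_sum_split_mat:
  "det (full_rep_mat M) = (\<Sum>B\<in>Pow {0..<ground_size M}. det (split_mat M B))"
proof -
  let ?n = "ground_size M" and ?r = "row_num M" and ?A = "full_rep_mat M"
  let ?P = "{p. p permutes {0..<?n}}"
  have det: "det C = (\<Sum>p\<in>?P. signof p * (\<Prod>i = 0..<?n. C $$ (p i, i)))"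
    if C: "C \<in> carrier_mat ?n ?n" for C :: "int mat"
  proof -
    have "det C = det C\<^sup>T" using det_transpose[OF C] by simp
    also have "\<dots> = (\<Sum>p\<in>?P. signof p * (\<Prod>i = 0..<?n. C\<^sup>T $$ (i, p i)))"
      using C by (intro det_def') auto
    also have "\<dots> = (\<Sum>p\<in>?P. signof p * (\<Prod>i = 0..<?n. C $$ (p i, i)))"
    proof (rule sum.cong[OF refl])
      fix p assume "p \<in> ?P"
      then have "p i < ?n" if "i < ?n" for i using permutes_in_image[of p "{0..<?n}" i] that by simp
      then have "(\<Prod>i = 0..<?n. C\<^sup>T $$ (i, p i)) = (\<Prod>i = 0..<?n. C $$ (p i, i))"
        using C by (intro prod.cong) auto
      then show "signof p * (\<Prod>i = 0..<?n. C\<^sup>T $$ (i, p i)) = signof p * (\<Prod>i = 0..<?n. C $$ (p i, i))"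
        by simp
    qed
    finally show ?thesis .
  qed
  have expand: "(\<Prod>i = 0..<?n. ?A $$ (p i, i)) =
      (\<Sum>B\<in>Pow {0..<?n}. \<Prod>i = 0..<?n. split_mat M B $$ (p i, i))" if p: "p permutes {0..<?n}" for p
  proof -
    let ?f = "\<lambda>i. if p i < ?r then ?A $$ (p i, i) else 0"
    let ?g = "\<lambda>i. if p i < ?r then 0 else ?A $$ (p i, i)"
    have "(\<Prod>i = 0..<?n. ?A $$ (p i, i)) = (\<Prod>i = 0..<?n. ?f i + ?g i)"
      by (intro prod.cong) auto
    also have "\<dots> = (\<Sum>B\<in>Pow {0..<?n}. prod ?f B * prod ?g ({0..<?n} - B))"
      by (rule prod_add) simp
    also have "\<dots> = (\<Sum>B\<in>Pow {0..<?n}. \<Prod>i = 0..<?n. split_mat M B $$ (p i, i))"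
    proof (rule sum.cong[OF refl])
      fix B assume B: "B \<in> Pow {0..<?n}"
      have p_lt: "p i < ?n" if "i < ?n" for i using permutes_in_image[OF p, of i] that by simp
      have "(\<Prod>i = 0..<?n. split_mat M B $$ (p i, i)) =
          (\<Prod>i\<in>B. split_mat M B $$ (p i, i)) * (\<Prod>i\<in>{0..<?n} - B. split_mat M B $$ (p i, i))"
        using B by (subst prod.subset_diff[of B]) (auto simp: mult.commute)
      also have "(\<Prod>i\<in>B. split_mat M B $$ (p i, i)) = prod ?f B"
        using B p_lt by (intro prod.cong) (auto simp: split_mat_def)
      also have "(\<Prod>i\<in>{0..<?n} - B. split_mat M B $$ (p i, i)) = prod ?g ({0..<?n} - B)"
        using B p_lt by (intro prod.cong) (auto simp: split_mat_def)
      finally show "prod ?f B * prod ?g ({0..<?n} - B) = (\<Prod>i = 0..<?n. split_mat M B $$ (p i, i))" by simp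
    qed
    finally show ?thesis .
  qed
  have "det ?A = (\<Sum>p\<in>?P. signof p * (\<Sum>B\<in>Pow {0..<?n}. \<Prod>i = 0..<?n. split_mat M B $$ (p i, i)))"
    unfolding det[OF full_rep_mat_carrier] by (intro sum.cong refl) (simp add: expand)
  also have "\<dots> = (\<Sum>B\<in>Pow {0..<?n}. \<Sum>p\<in>?P. signof p * (\<Prod>i = 0..<?n. split_mat M B $$ (p i, i)))"
    unfolding sum_distrib_left by (rule sum.swap)
  also have "\<dots> = (\<Sum>B\<in>Pow {0..<?n}. det (split_mat M B))"
    by (intro sum.cong refl det[symmetric]) (simp add: split_mat_def)
  finally show ?thesis .
qed

text \<open>The same number as the Cauchy-Binet expansion of the determinant of \<open>D\<close>
  times its transpose.\<close>

lemma det_full_rep_mat: "det (full_rep_mat M) = (\<Sum>B\<in>bases M. (basis_det M B)\<^sup>2)"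
proof -
  let ?n = "ground_size M"
  have "det (full_rep_mat M) = (\<Sum>B\<in>Pow {0..<?n}. det (split_mat M B))"
    by (rule det_full_rep_mat_eq_sum_split_mat)
  also have "\<dots> = (\<Sum>B\<in>bases M. det (split_mat M B))"
  proof (rule sum.mono_neutral_right)
    show "\<forall>B\<in>Pow {0..<?n} - bases M. det (split_mat M B) = 0"
    proof
      fix B assume "B \<in> Pow {0..<?n} - bases M"
      then have B: "B \<subseteq> {0..<?n}" and "card B \<noteq> row_num M \<or> basis_det M B = 0"
        by (auto simp: bases_def)
      then show "det (split_mat M B) = 0"
        using det_split_mat_eq_0[OF B] det_split_mat[OF B] by (cases "card B = row_num M") auto
    qed
  qed (auto simp: bases_def)
  also have "\<dots> = (\<Sum>B\<in>bases M. (basis_det M B)\<^sup>2)"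
    by (intro sum.cong refl) (auto simp: bases_def det_split_mat)
  finally show ?thesis .
qed

section \<open>Facets of a parallelepiped\<close>

lemma det_nonzero_inverse:
  fixes A :: "'a :: field mat"
  assumes "A \<in> carrier_mat n n" and "det A \<noteq> 0"
  obtains K where "K \<in> carrier_mat n n" and "A * K = 1\<^sub>m n" and "K * A = 1\<^sub>m n"
  using det_non_zero_imp_unit[OF assms, of "()"] unfolding Units_def ring_mat_def by auto

text \<open>Only the facets through the origin are needed: the opposite facet, where coordinate
  \<open>i\<close> is 1, has the same direction space.\<close>

definition facet_at :: "real mat \<Rightarrow> nat \<Rightarrow> real vec set" where
  "facet_at A i = {A *\<^sub>v a | a. a \<in> carrier_vec (dim_col A) \<and> (\<forall>j<dim_col A. 0 \<le> a $ j \<and> a $ j \<le> 1) \<and> a $ i = 0}"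

context
  fixes A K :: "real mat" and n :: nat
  assumes A: "A \<in> carrier_mat n n" and K: "K \<in> carrier_mat n n"
    and AK: "A * K = 1\<^sub>m n" and KA: "K * A = 1\<^sub>m n"
begin

lemma left_inverse_mult_vec: "v \<in> carrier_vec n \<Longrightarrow> K *\<^sub>v (A *\<^sub>v v) = v"
  using A K KA by (simp flip: assoc_mult_mat_vec[of _ n n _ n])

lemma right_inverse_mult_vec: "v \<in> carrier_vec n \<Longrightarrow> A *\<^sub>v (K *\<^sub>v v) = v"
  using A K AK by (simp flip: assoc_mult_mat_vec[of _ n n _ n])

lemma fund_parallelepiped_iff:
  "x \<in> fund_parallelepiped A \<longleftrightarrow> x \<in> carrier_vec n \<and> (\<forall>i<n. 0 \<le> (K *\<^sub>v x) $ i \<and> (K *\<^sub>v x) $ i \<le> 1)"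
proof
  assume "x \<in> fund_parallelepiped A"
  then show "x \<in> carrier_vec n \<and> (\<forall>i<n. 0 \<le> (K *\<^sub>v x) $ i \<and> (K *\<^sub>v x) $ i \<le> 1)"
    using A unfolding fund_parallelepiped_def by (auto simp: left_inverse_mult_vec)
next
  assume x: "x \<in> carrier_vec n \<and> (\<forall>i<n. 0 \<le> (K *\<^sub>v x) $ i \<and> (K *\<^sub>v x) $ i \<le> 1)"
  then have "x = A *\<^sub>v (K *\<^sub>v x)" by (simp add: right_inverse_mult_vec)
  moreover have "K *\<^sub>v x \<in> carrier_vec (dim_col A)" using A K x by auto
  ultimately show "x \<in> fund_parallelepiped A"
    using A x unfolding fund_parallelepiped_def by auto
qed

lemma mult_unit_vec: "j < n \<Longrightarrow> A *\<^sub>v unit_vec n j = col A j"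
  using A by (intro eq_vecI) auto

lemma inj_on_col: "inj_on (col A) {0..<n}"
proof (rule inj_onI)
  fix i j assume ij: "i \<in> {0..<n}" "j \<in> {0..<n}" "col A i = col A j"
  then have "A *\<^sub>v unit_vec n i = A *\<^sub>v unit_vec n j"
    by (simp add: mult_unit_vec)
  then have "unit_vec n i = (unit_vec n j :: real vec)"
    using left_inverse_mult_vec by (metis unit_vec_carrier)
  then show "i = j" using ij by (metis atLeastLessThan_iff index_unit_vec(1) zero_neq_one)
qed

text \<open>The direction space is spanned by the \<open>n - 1\<close> columns other than column
  \<open>i\<close>, which are independent because \<open>A\<close> is invertible. A vector whose
  coordinate \<open>i\<close> in the edge basis vanishes is a combination of these columns.\<close>

lemma facet_at_direction:
  assumes i: "i < n"
  shows "subspace_dim n (direction_space n (facet_at A i)) + 1 = n"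
    and "w \<in> carrier_vec n \<Longrightarrow> (K *\<^sub>v w) $ i = 0 \<Longrightarrow> w \<in> direction_space n (facet_at A i)"
proof -
  interpret vec_space "TYPE(real)" n .
  let ?J = "{0..<n} - {i}"
  let ?S = "col A ` ?J"
  let ?F = "facet_at A i"
  let ?D = "{x - y | x y. x \<in> ?F \<and> y \<in> ?F}"
  have S: "?S \<subseteq> carrier_vec n" "finite ?S" using A by auto
  have injJ: "inj_on (col A) ?J" using inj_on_col by (rule inj_on_subset) auto
  have in_span: "A *\<^sub>v v \<in> span ?S" if v: "v \<in> carrier_vec n" "v $ i = 0" for v
  proof (rule in_spanI[where a = "\<lambda>c. v $ the_inv_into ?J (col A) c" and A = ?S])
    show "A *\<^sub>v v = lincomb (\<lambda>c. v $ the_inv_into ?J (col A) c) ?S"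
    proof (rule eq_vecI)
      fix k assume "k < dim_vec (lincomb (\<lambda>c. v $ the_inv_into ?J (col A) c) ?S)"
      then have k: "k < n" using lincomb_dim[OF S(2,1)] by simp
      have "lincomb (\<lambda>c. v $ the_inv_into ?J (col A) c) ?S $ k
          = (\<Sum>x\<in>?S. v $ the_inv_into ?J (col A) x * x $ k)"
        by (rule lincomb_index[OF k S(1)])
      also have "\<dots> = (\<Sum>j\<in>?J. v $ j * A $$ (k, j))"
        using A k by (subst sum.reindex[OF injJ]) (auto simp: the_inv_into_f_f[OF injJ] intro!: sum.cong)
      also have "\<dots> = (\<Sum>j\<in>{0..<n}. A $$ (k, j) * v $ j)"
        using i v by (subst (2) sum.remove[of _ i]) (auto simp: mult.commute)
      also have "\<dots> = (A *\<^sub>v v) $ k" using A k v by (simp add: scalar_prod_def)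
      finally show "(A *\<^sub>v v) $ k = lincomb (\<lambda>c. v $ the_inv_into ?J (col A) c) ?S $ k" by simp
    qed (use A lincomb_dim[OF S(2,1)] in auto)
  qed (use S in auto)
  have dir: "direction_space n ?F = span ?S"
  proof
    have "?D \<subseteq> span ?S"
    proof
      fix x assume "x \<in> ?D"
      then obtain a b where ab: "a \<in> carrier_vec n" "b \<in> carrier_vec n" "a $ i = 0" "b $ i = 0"
        "x = A *\<^sub>v a - A *\<^sub>v b" using A unfolding facet_at_def by auto
      then have "x = A *\<^sub>v (a - b)" using A by (simp add: mult_minus_distrib_mat_vec)
      then show "x \<in> span ?S" using in_span[of "a - b"] ab i by simp
    qed
    then show "direction_space n ?F \<subseteq> span ?S"
      unfolding direction_space_def by (rule span_subsetI[OF S(1)])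
    \<comment> \<open>The facet contains the origin and each of these columns, so every column is a
      difference of two of its points.\<close>
    have "?S \<subseteq> ?D"
    proof
      fix x assume "x \<in> ?S"
      then obtain j where "j \<in> ?J" "x = col A j" by (rule imageE)
      then have j: "j < n" "j \<noteq> i" "x = col A j" by simp_all
      have z: "A *\<^sub>v 0\<^sub>v n = 0\<^sub>v n" using A by auto
      have "col A j \<in> ?F"
        unfolding facet_at_def mem_Collect_eq
        by (intro exI[of _ "unit_vec n j"]) (use A j i in \<open>auto simp: mult_unit_vec\<close>)
      moreover have "0\<^sub>v n \<in> ?F"
        unfolding facet_at_def mem_Collect_eq
        by (intro exI[of _ "0\<^sub>v n"]) (use A i z in auto)
      moreover have "x = col A j - 0\<^sub>v n" using A j by auto
      ultimately show "x \<in> ?D" by blast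
    qed
    then show "span ?S \<subseteq> direction_space n ?F"
      unfolding direction_space_def by (rule span_is_monotone)
  qed
  have "det A \<noteq> 0"
    using det_mult[OF A K] AK by auto
  then have "lin_indpt (set (cols A))" using lin_dep_cols_imp_det_0[OF A] by blast
  moreover have "?S \<subseteq> set (cols A)" using A by (auto simp: cols_def)
  ultimately have "lin_indpt ?S" by (rule subset_li_is_li)
  then have "maximal ?S (\<lambda>T. T \<subseteq> ?S \<and> lin_indpt T)" unfolding maximal_def by blast
  then have "vectorspace.dim class_ring (span_vs ?S) = card ?S"
    by (rule dim_span[OF S])
  also have "card ?S = n - 1" using card_image[OF injJ] i by simp
  finally show "subspace_dim n (direction_space n (facet_at A i)) + 1 = n"
    unfolding subspace_dim_def dir using i by simp
  assume w: "w \<in> carrier_vec n" "(K *\<^sub>v w) $ i = 0"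
  have "K *\<^sub>v w \<in> carrier_vec n" using K w by auto
  then have "A *\<^sub>v (K *\<^sub>v w) \<in> span ?S" by (rule in_span[OF _ w(2)])
  then show "w \<in> direction_space n (facet_at A i)"
    unfolding dir using right_inverse_mult_vec[OF w(1)] by simp
qed

text \<open>Row \<open>i\<close> of the inverse reads off the edge coordinate \<open>i\<close>; its
  negative is the supporting functional, with bound 0.\<close>

lemma is_face_facet_at:
  assumes i: "i < n"
  shows "is_face n (facet_at A i) (fund_parallelepiped A)"
proof -
  let ?u = "- row K i"
  have u: "?u \<bullet> (A *\<^sub>v a) = - a $ i" if "a \<in> carrier_vec n" for a
  proof -
    have "?u \<bullet> (A *\<^sub>v a) = - (K *\<^sub>v (A *\<^sub>v a)) $ i" using A K i that by simp
    then show ?thesis using left_inverse_mult_vec[OF that] by simp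
  qed
  have "facet_at A i = {x \<in> fund_parallelepiped A. ?u \<bullet> x = 0}"
    using A u unfolding facet_at_def fund_parallelepiped_def by auto
  moreover have "\<forall>x\<in>fund_parallelepiped A. ?u \<bullet> x \<le> 0"
    using A u i unfolding fund_parallelepiped_def by auto
  moreover have "A *\<^sub>v 0\<^sub>v n \<in> facet_at A i"
    using A i unfolding facet_at_def by (auto intro!: exI[of _ "0\<^sub>v n"])
  moreover have "?u \<in> carrier_vec n" using K by auto
  ultimately show ?thesis unfolding is_face_def by blast
qed

text \<open>Translates the facet condition on shifting vectors into the form in which the rest of
  the proof uses it: no edge coordinate of \<open>w\<close> vanishes.\<close>

lemma generic_coordinate_nonzero:
  assumes "w \<in> carrier_vec n" and "i < n"
    and "\<And>F. is_facet n F (fund_parallelepiped A) \<Longrightarrow> w \<notin> direction_space n F"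
  shows "(K *\<^sub>v w) $ i \<noteq> 0"
  using assms(3)[of "facet_at A i"] is_face_facet_at facet_at_direction assms(1,2)
  unfolding is_facet_def by blast

end

section \<open>Integer points in shifted parallelepipeds\<close>

text \<open>The numbers \<open>c\<close> such that \<open>c + \<epsilon> d\<close> lies in the unit interval for all small \<open>\<epsilon> > 0\<close>, when \<open>d \<noteq> 0\<close>.\<close>

definition shifted_unit :: "real \<Rightarrow> real \<Rightarrow> bool" where
  "shifted_unit d c \<longleftrightarrow> (if 0 < d then 0 \<le> c \<and> c < 1 else 0 < c \<and> c \<le> 1)"

lemma shifted_unit_eventually:
  assumes "d \<noteq> 0" and "shifted_unit d c"
  shows "\<forall>\<^sub>F \<epsilon> in at_right 0. 0 < c + \<epsilon> * d \<and> c + \<epsilon> * d < 1"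
proof (cases "0 < d")
  case True
  then have c: "0 \<le> c" "c < 1" using assms by (auto simp: shifted_unit_def)
  have "0 < c + \<epsilon> * d \<and> c + \<epsilon> * d < 1" if "0 < \<epsilon>" "\<epsilon> < (1 - c) / d" for \<epsilon>
    using that True c by (auto simp: field_simps intro: add_nonneg_pos)
  then show ?thesis
    unfolding eventually_at_right_field using True c by (intro exI[of _ "(1 - c) / d"]) auto
next
  case False
  then have c: "0 < c" "c \<le> 1" and d: "d < 0" using assms by (auto simp: shifted_unit_def)
  have "0 < c + \<epsilon> * d \<and> c + \<epsilon> * d < 1" if "0 < \<epsilon>" "\<epsilon> < c / (- d)" for \<epsilon>
  proof -
    have "\<epsilon> * (- d) < c" using that(2) d by (subst (asm) pos_less_divide_eq) auto
    moreover have "\<epsilon> * d < 0" using that(1) d by (rule mult_pos_neg)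
    ultimately show ?thesis using c by simp
  qed
  then show ?thesis
    unfolding eventually_at_right_field using d c by (intro exI[of _ "c / (- d)"]) (auto simp: divide_pos_neg)
qed

lemma not_shifted_unit_eventually:
  assumes "d \<noteq> 0" and "\<not> shifted_unit d c"
  shows "\<forall>\<^sub>F \<epsilon> in at_right 0. \<not> (0 \<le> c + \<epsilon> * d \<and> c + \<epsilon> * d \<le> 1)"
proof -
  have lim: "((\<lambda>\<epsilon>. c + \<epsilon> * d) \<longlongrightarrow> c) (at_right 0)" by (auto intro!: tendsto_eq_intros)
  \<comment> \<open>Outside the closed interval the point stays outside by continuity; at an
    endpoint from which \<open>d\<close> points outward it leaves at once.\<close>
  consider "c < 0" | "1 < c" | "0 < d" "c = 1" | "d < 0" "c = 0"
    using assms unfolding shifted_unit_def by (auto split: if_splits) (linarith+)?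
  then show ?thesis
  proof cases
    case 1
    then show ?thesis using order_tendstoD(2)[OF lim, of 0] by (auto elim: eventually_mono)
  next
    case 2
    then show ?thesis using order_tendstoD(1)[OF lim, of 1] by (auto elim: eventually_mono)
  next
    case 3
    then show ?thesis
      using eventually_at_right_less[of 0] by (auto elim!: eventually_mono simp: zero_less_mult_iff not_le)
  next
    case 4
    then show ?thesis
      using eventually_at_right_less[of 0] by (auto elim!: eventually_mono simp: mult_pos_neg not_le)
  qed
qed

text \<open>A half-open interval of length one meets each coset of the integers once. The
  translation is the floor for the interval closed on the left, and the ceiling minus one for the
  interval closed on the right.\<close>

lemma shifted_unit_ex1_integer:
  "\<exists>!k::int. shifted_unit d (c - of_int k)"
proof (cases "0 < d")
  case True
  show ?thesis
  proof (rule ex1I[of _ "\<lfloor>c\<rfloor>"])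
    show "shifted_unit d (c - of_int \<lfloor>c\<rfloor>)" using True unfolding shifted_unit_def by simp linarith
    fix k :: int assume "shifted_unit d (c - of_int k)"
    then show "k = \<lfloor>c\<rfloor>" using True unfolding shifted_unit_def by simp linarith
  qed
next
  case False
  show ?thesis
  proof (rule ex1I[of _ "\<lceil>c\<rceil> - 1"])
    show "shifted_unit d (c - of_int (\<lceil>c\<rceil> - 1))" using False unfolding shifted_unit_def by simp linarith
    fix k :: int assume "shifted_unit d (c - of_int k)"
    then show "k = \<lceil>c\<rceil> - 1" using False unfolding shifted_unit_def by simp linarith
  qed
qed

section \<open>Generic shifts relative to a single parallelepiped\<close>

context
  fixes A K :: "real mat" and n :: nat and w :: "real vec"
  assumes A: "A \<in> carrier_mat n n" and K: "K \<in> carrier_mat n n"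
    and AK: "A * K = 1\<^sub>m n" and KA: "K * A = 1\<^sub>m n"
    and w: "w \<in> carrier_vec n" and generic: "\<And>i. i < n \<Longrightarrow> (K *\<^sub>v w) $ i \<noteq> 0"
begin

lemma inverse_mult_shift:
  assumes "x \<in> carrier_vec n" and "i < n"
  shows "(K *\<^sub>v (x + \<epsilon> \<cdot>\<^sub>v w)) $ i = (K *\<^sub>v x) $ i + \<epsilon> * (K *\<^sub>v w) $ i"
  using assms K w by (simp add: mult_add_distrib_mat_vec[of _ n n] mult_mat_vec[of _ n n] del: index_mult_mat_vec)

text \<open>The bounds are strict although \<open>x\<close> itself may lie on the boundary: each
  coordinate starting at an endpoint moves inward. The disjointness of cells needs interior
  points.\<close>

lemma shifted_in_interior:
  assumes x: "x \<in> carrier_vec n" and "\<forall>i<n. shifted_unit ((K *\<^sub>v w) $ i) ((K *\<^sub>v x) $ i)"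
  shows "\<forall>\<^sub>F \<epsilon> in at_right 0. \<forall>i<n. 0 < (K *\<^sub>v (x + \<epsilon> \<cdot>\<^sub>v w)) $ i \<and> (K *\<^sub>v (x + \<epsilon> \<cdot>\<^sub>v w)) $ i < 1"
proof -
  have "\<forall>\<^sub>F \<epsilon> in at_right 0. \<forall>i\<in>{..<n}. 0 < (K *\<^sub>v x) $ i + \<epsilon> * (K *\<^sub>v w) $ i \<and> (K *\<^sub>v x) $ i + \<epsilon> * (K *\<^sub>v w) $ i < 1"
    using assms generic by (intro eventually_ball_finite ballI shifted_unit_eventually) auto
  then show ?thesis by (rule eventually_mono) (simp add: inverse_mult_shift[OF x])
qed

lemma shifted_in_fund_parallelepiped:
  assumes x: "x \<in> carrier_vec n" and "\<forall>i<n. shifted_unit ((K *\<^sub>v w) $ i) ((K *\<^sub>v x) $ i)"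
  shows "\<forall>\<^sub>F \<epsilon> in at_right 0. x + \<epsilon> \<cdot>\<^sub>v w \<in> fund_parallelepiped A"
  using shifted_in_interior[OF assms]
  by (rule eventually_mono) (use x w in \<open>auto simp: fund_parallelepiped_iff[OF A K AK KA] less_imp_le\<close>)

lemma shifted_notin_fund_parallelepiped:
  assumes x: "x \<in> carrier_vec n" and "\<not> (\<forall>i<n. shifted_unit ((K *\<^sub>v w) $ i) ((K *\<^sub>v x) $ i))"
  shows "\<forall>\<^sub>F \<epsilon> in at_right 0. x + \<epsilon> \<cdot>\<^sub>v w \<notin> fund_parallelepiped A"
proof -
  from assms(2) obtain i where i: "i < n" "\<not> shifted_unit ((K *\<^sub>v w) $ i) ((K *\<^sub>v x) $ i)" by blast
  from not_shifted_unit_eventually[OF generic[OF i(1)] i(2)] show ?thesis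
    by (rule eventually_mono) (use i(1) in \<open>auto simp: fund_parallelepiped_iff[OF A K AK KA] inverse_mult_shift[OF x i(1)]\<close>)
qed

lemma shifted_in_fund_parallelepiped_iff:
  assumes x: "x \<in> carrier_vec n"
  shows "(\<forall>\<^sub>F \<epsilon> in at_right 0. x + \<epsilon> \<cdot>\<^sub>v w \<in> fund_parallelepiped A) \<longleftrightarrow>
    (\<forall>i<n. shifted_unit ((K *\<^sub>v w) $ i) ((K *\<^sub>v x) $ i))" (is "?L \<longleftrightarrow> ?R")
proof
  assume ?L
  show ?R
  proof (rule ccontr)
    assume "\<not> ?R"
    from eventually_conj[OF \<open>?L\<close> shifted_notin_fund_parallelepiped[OF x this]]
    have "\<forall>\<^sub>F \<epsilon> in at_right (0::real). False" by (rule eventually_mono) blast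
    then show False by simp
  qed
qed (rule shifted_in_fund_parallelepiped[OF x])

text \<open>In edge coordinates the lattice becomes the integer lattice and the shifted cell a
  product of half-open unit intervals, so the coordinates can be reduced independently.\<close>

lemma transversal_fund_parallelepiped:
  assumes C: "C \<in> carrier_mat n n" and AC: "A = map_mat real_of_int C"
  shows "transversal C {z \<in> carrier_vec n. \<forall>\<^sub>F \<epsilon> in at_right 0. map_vec real_of_int z + \<epsilon> \<cdot>\<^sub>v w \<in> fund_parallelepiped A}"
proof -
  let ?h = "map_vec real_of_int"
  let ?Q = "\<lambda>z. \<forall>i<n. shifted_unit ((K *\<^sub>v w) $ i) ((K *\<^sub>v ?h z) $ i)"
  \<comment> \<open>Subtracting a vector of the edge lattice changes the edge coordinates by its
    integer coefficients.\<close>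
  have K_diff: "(K *\<^sub>v ?h (x - C *\<^sub>v v)) $ i = (K *\<^sub>v ?h x) $ i - real_of_int (v $ i)"
    if "x \<in> carrier_vec n" "v \<in> carrier_vec n" "i < n" for x v i
  proof -
    have "?h (x - C *\<^sub>v v) = ?h x - ?h (C *\<^sub>v v)" using that C by (intro eq_vecI) auto
    also have "?h (C *\<^sub>v v) = A *\<^sub>v ?h v"
      unfolding AC by (rule of_int_hom.mult_mat_vec_hom[OF C that(2)])
    finally have "K *\<^sub>v ?h (x - C *\<^sub>v v) = K *\<^sub>v ?h x - K *\<^sub>v (A *\<^sub>v ?h v)"
      using that A K by (simp add: mult_minus_distrib_mat_vec[of _ n n])
    also have "K *\<^sub>v (A *\<^sub>v ?h v) = ?h v" using that by (intro left_inverse_mult_vec[OF A K AK KA]) auto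
    finally show ?thesis using that K by simp
  qed
  have "\<exists>!y. y \<in> {z \<in> carrier_vec n. ?Q z} \<and> (\<exists>v\<in>carrier_vec n. x = y + C *\<^sub>v v)"
    if x: "x \<in> carrier_vec n" for x
  proof -
    define k where "k i = (THE k. shifted_unit ((K *\<^sub>v w) $ i) ((K *\<^sub>v ?h x) $ i - real_of_int k))" for i
    have k: "shifted_unit ((K *\<^sub>v w) $ i) ((K *\<^sub>v ?h x) $ i - real_of_int (k i))" for i
      unfolding k_def by (rule theI'[OF shifted_unit_ex1_integer])
    have k_uniq: "l = k i" if "shifted_unit ((K *\<^sub>v w) $ i) ((K *\<^sub>v ?h x) $ i - real_of_int l)" for l i
      using shifted_unit_ex1_integer k that by blast
    have Q: "?Q (x - C *\<^sub>v v) \<longleftrightarrow> v = vec n k" if v: "v \<in> carrier_vec n" for v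
      using K_diff[OF x v] k k_uniq v by (auto intro!: eq_vecI)
    have move: "x = y + C *\<^sub>v v \<longleftrightarrow> y = x - C *\<^sub>v v" if "v \<in> carrier_vec n" "y \<in> carrier_vec n" for v y
      using x that C by (auto simp: vec_eq_iff)
    show ?thesis
    proof (rule ex1I[of _ "x - C *\<^sub>v vec n k"])
      have c: "x - C *\<^sub>v vec n k \<in> carrier_vec n" using x C by auto
      then have "x = x - C *\<^sub>v vec n k + C *\<^sub>v vec n k"
        using move[OF vec_carrier c] by simp
      moreover have "?Q (x - C *\<^sub>v vec n k)" using Q[OF vec_carrier] by simp
      ultimately show "x - C *\<^sub>v vec n k \<in> {z \<in> carrier_vec n. ?Q z} \<and>
          (\<exists>v\<in>carrier_vec n. x = x - C *\<^sub>v vec n k + C *\<^sub>v v)"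
        using c vec_carrier by blast
    next
      fix y assume "y \<in> {z \<in> carrier_vec n. ?Q z} \<and> (\<exists>v\<in>carrier_vec n. x = y + C *\<^sub>v v)"
      then obtain v where v: "v \<in> carrier_vec n" "y \<in> carrier_vec n" "?Q y" "x = y + C *\<^sub>v v" by blast
      then have y: "y = x - C *\<^sub>v v" using move by blast
      then show "y = x - C *\<^sub>v vec n k" using Q[OF v(1)] v(3) by simp
    qed
  qed
  moreover have "{z \<in> carrier_vec n. \<forall>\<^sub>F \<epsilon> in at_right 0. ?h z + \<epsilon> \<cdot>\<^sub>v w \<in> fund_parallelepiped A} =
      {z \<in> carrier_vec n. ?Q z}"
    by (auto simp: shifted_in_fund_parallelepiped_iff)
  ultimately show ?thesis unfolding transversal_def lattice_cong_def using C by auto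
qed

end

text \<open>A product of two parallelepipeds is the one spanned by the block diagonal matrix; this
  makes the general results available for cells.\<close>

lemma basis_cell_eq_fund_parallelepiped:
  assumes B: "B \<subseteq> {0..<ground_size M}" "card B = row_num M"
  shows "basis_cell M B = fund_parallelepiped (map_mat real_of_int (cell_mat M B))"
proof -
  let ?r = "row_num M" and ?m = "dim_col M"
  let ?h = "map_mat real_of_int"
  define D where "D = ?h (submatrix (std_rep_mat M) UNIV B)"
  define E where "E = ?h (submatrix (dual_rep_mat M) UNIV ({0..<ground_size M} - B))"
  have D: "D \<in> carrier_mat ?r ?r" and E: "E \<in> carrier_mat ?m ?m"
    using submatrix_std_rep_carrier[OF B] submatrix_dual_rep_carrier[OF B] by (auto simp: D_def E_def)
  have zero: "?h (0\<^sub>m i j) = 0\<^sub>m i j" for i j by (intro eq_matI) auto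
  have H: "?h (cell_mat M B) = four_block_mat D (0\<^sub>m ?r ?m) (0\<^sub>m ?m ?r) E"
    unfolding cell_mat_def D_def E_def
    using map_four_block_mat[OF submatrix_std_rep_carrier[OF B] _ _ submatrix_dual_rep_carrier[OF B],
        of "0\<^sub>m ?r ?m" "0\<^sub>m ?m ?r" real_of_int]
    by (simp add: zero)
  have dimH: "dim_col (?h (cell_mat M B)) = ?r + ?m" unfolding H using D E by simp
  have mult: "?h (cell_mat M B) *\<^sub>v (a @\<^sub>v b) = (D *\<^sub>v a) @\<^sub>v (E *\<^sub>v b)"
    if "a \<in> carrier_vec ?r" "b \<in> carrier_vec ?m" for a b
    unfolding H using mult_mat_vec_split[OF D E that] .
  have unit: "(\<forall>i<?r + ?m. 0 \<le> (a @\<^sub>v b) $ i \<and> (a @\<^sub>v b) $ i \<le> 1) \<longleftrightarrow>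
      (\<forall>i<?r. 0 \<le> a $ i \<and> a $ i \<le> 1) \<and> (\<forall>i<?m. 0 \<le> b $ i \<and> b $ i \<le> 1)"
    if "a \<in> carrier_vec ?r" "b \<in> carrier_vec ?m" for a b :: "real vec"
  proof safe
    fix i assume *: "\<forall>i<?r + ?m. 0 \<le> (a @\<^sub>v b) $ i \<and> (a @\<^sub>v b) $ i \<le> 1"
    show "0 \<le> a $ i" "a $ i \<le> 1" if "i < ?r"
      using *[rule_format, of i] that \<open>a \<in> _\<close> \<open>b \<in> _\<close> by auto
    show "0 \<le> b $ i" "b $ i \<le> 1" if "i < ?m"
      using *[rule_format, of "?r + i"] that \<open>a \<in> _\<close> \<open>b \<in> _\<close> by auto
  qed (use that in auto)
  have "basis_cell M B = {(D *\<^sub>v a) @\<^sub>v (E *\<^sub>v b) | a b. a \<in> carrier_vec ?r \<and> b \<in> carrier_vec ?m \<and>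
      (\<forall>i<?r. 0 \<le> a $ i \<and> a $ i \<le> 1) \<and> (\<forall>i<?m. 0 \<le> b $ i \<and> b $ i \<le> 1)}"
    unfolding basis_cell_def P1_def P2_def fund_parallelepiped_def D_def[symmetric] E_def[symmetric]
      carrier_matD(2)[OF D] carrier_matD(2)[OF E] by blast
  also have "\<dots> = fund_parallelepiped (?h (cell_mat M B))" (is "?X = _")
  proof
    show "?X \<subseteq> fund_parallelepiped (?h (cell_mat M B))"
    proof
      fix x assume "x \<in> ?X"
      then obtain a b where ab: "x = (D *\<^sub>v a) @\<^sub>v (E *\<^sub>v b)" "a \<in> carrier_vec ?r" "b \<in> carrier_vec ?m"
        "(\<forall>i<?r. 0 \<le> a $ i \<and> a $ i \<le> 1) \<and> (\<forall>i<?m. 0 \<le> b $ i \<and> b $ i \<le> 1)" by blast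
      then have "x = ?h (cell_mat M B) *\<^sub>v (a @\<^sub>v b)" "a @\<^sub>v b \<in> carrier_vec (?r + ?m)"
        "\<forall>i<?r + ?m. 0 \<le> (a @\<^sub>v b) $ i \<and> (a @\<^sub>v b) $ i \<le> 1"
        using mult unit[OF ab(2,3)] by auto
      then show "x \<in> fund_parallelepiped (?h (cell_mat M B))"
        unfolding fund_parallelepiped_def dimH by blast
    qed
    show "fund_parallelepiped (?h (cell_mat M B)) \<subseteq> ?X"
    proof
      fix x assume "x \<in> fund_parallelepiped (?h (cell_mat M B))"
      then obtain v where v: "x = ?h (cell_mat M B) *\<^sub>v v" "v \<in> carrier_vec (?r + ?m)"
        "\<forall>i<?r + ?m. 0 \<le> v $ i \<and> v $ i \<le> 1" unfolding fund_parallelepiped_def dimH by blast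
      define a b where "a = vec_first v ?r" and "b = vec_last v ?m"
      have ab: "a \<in> carrier_vec ?r" "b \<in> carrier_vec ?m" "v = a @\<^sub>v b"
        using v(2) by (auto simp: a_def b_def)
      then show "x \<in> ?X" using v(1,3) mult[OF ab(1,2)] unit[OF ab(1,2)] by blast
    qed
  qed
  finally show ?thesis .
qed

section \<open>Disjointness of the cells modulo the lattice\<close>

text \<open>The full matrix is the identity plus a skew-symmetric matrix supported on the
  off-diagonal blocks.\<close>

lemma full_rep_mat_skew:
  assumes "i < ground_size M" and "k < ground_size M"
  shows "full_rep_mat M $$ (k, i) =
    (if i < row_num M \<longleftrightarrow> k < row_num M then (if i = k then 1 else 0) else - full_rep_mat M $$ (i, k))"
  using assms by (auto simp: full_rep_mat_index std_rep_mat_index dual_rep_mat_index ground_size_def row_num_def)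

text \<open>The equations for \<open>x\<close> in the upper rows are weighted by \<open>y\<close>,
  those for \<open>y\<close> in the lower rows by \<open>x\<close>. In the total, the off-diagonal
  blocks cancel by skew symmetry and the identity blocks leave the scalar product.\<close>

lemma full_rep_mat_kernels_orthogonal:
  fixes x y :: "nat \<Rightarrow> real"
  assumes x: "\<And>i. i < row_num M \<Longrightarrow> (\<Sum>j<ground_size M. of_int (full_rep_mat M $$ (i, j)) * x j) = 0"
    and y: "\<And>i. row_num M \<le> i \<Longrightarrow> i < ground_size M \<Longrightarrow>
      (\<Sum>j<ground_size M. of_int (full_rep_mat M $$ (i, j)) * y j) = 0"
  shows "(\<Sum>j<ground_size M. x j * y j) = 0"
proof -
  let ?n = "ground_size M" and ?r = "row_num M"
  let ?a = "\<lambda>i j. real_of_int (full_rep_mat M $$ (i, j))"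
  let ?g = "\<lambda>i j. ?a i j * (if i < ?r then y i * x j else x i * y j)"
  \<comment> \<open>Each row sum of \<open>g\<close> vanishes, whereas \<open>g + g\<^sup>T\<close> is twice the diagonal of the products.\<close>
  have row: "(\<Sum>j<?n. ?g i j) = 0" if "i < ?n" for i
  proof (cases "i < ?r")
    case True
    then have "(\<Sum>j<?n. ?g i j) = y i * (\<Sum>j<?n. ?a i j * x j)"
      by (simp add: sum_distrib_left mult_ac)
    then show ?thesis using x[OF True] by simp
  next
    case False
    then have "(\<Sum>j<?n. ?g i j) = x i * (\<Sum>j<?n. ?a i j * y j)"
      by (simp add: sum_distrib_left mult_ac)
    then show ?thesis using y[of i] False that by simp
  qed
  have pair: "?g i j + ?g j i = (if i = j then 2 * (x i * y i) else 0)" if "i < ?n" "j < ?n" for i j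
  proof (cases "i < ?r \<longleftrightarrow> j < ?r")
    case True
    then have "full_rep_mat M $$ (i, j) = (if i = j then 1 else 0)"
      "full_rep_mat M $$ (j, i) = (if i = j then 1 else 0)"
      using full_rep_mat_skew[OF that] full_rep_mat_skew[OF that(2,1)] by auto
    then show ?thesis using True by simp
  next
    case False
    then have "full_rep_mat M $$ (j, i) = - full_rep_mat M $$ (i, j)"
      using full_rep_mat_skew[OF that] by simp
    then show ?thesis using False by auto
  qed
  have "(\<Sum>i<?n. \<Sum>j<?n. ?g i j + ?g j i) = (\<Sum>i<?n. \<Sum>j<?n. ?g i j) + (\<Sum>i<?n. \<Sum>j<?n. ?g j i)"
    by (simp only: sum.distrib)
  also have "(\<Sum>i<?n. \<Sum>j<?n. ?g j i) = (\<Sum>i<?n. \<Sum>j<?n. ?g i j)"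
    by (rule sum.swap)
  finally have "(\<Sum>i<?n. \<Sum>j<?n. ?g i j + ?g j i) = 0" using row by simp
  moreover have "(\<Sum>i<?n. \<Sum>j<?n. ?g i j + ?g j i) = (\<Sum>i<?n. 2 * (x i * y i))"
  proof (rule sum.cong[OF refl])
    fix i assume i: "i \<in> {..<?n}"
    then have "(\<Sum>j<?n. ?g i j + ?g j i) = (\<Sum>j<?n. if i = j then 2 * (x i * y i) else 0)"
      using pair by (intro sum.cong) auto
    then show "(\<Sum>j<?n. ?g i j + ?g j i) = 2 * (x i * y i)" using i by simp
  qed
  ultimately show ?thesis by (simp add: sum_distrib_left[symmetric])
qed

text \<open>Undoes the enumeration of columns, which depends on \<open>B\<close>, so that points of
  two different cells can be compared column by column. Of the reordered coordinates
  \<open>e\<close> only their bounds matter later, hence the weak first property.\<close>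

lemma cell_mat_mult_vec_index:
  fixes a :: "real vec"
  assumes B: "B \<subseteq> {0..<ground_size M}" "card B = row_num M"
    and a: "a \<in> carrier_vec (ground_size M)"
  obtains e where "\<And>j. j < ground_size M \<Longrightarrow> \<exists>k<ground_size M. e j = a $ k"
    and "\<And>i. i < ground_size M \<Longrightarrow> (map_mat real_of_int (cell_mat M B) *\<^sub>v a) $ i =
      (\<Sum>j<ground_size M. of_int (full_rep_mat M $$ (i, j)) * (if i < row_num M \<longleftrightarrow> j \<in> B then e j else 0))"
proof -
  let ?n = "ground_size M" and ?r = "row_num M" and ?s = "basis_enum M B"
  note perm = basis_enum_permutes[OF B]
  define t where "t = inv_into UNIV ?s"
  have t: "t (?s k) = k" for k using permutes_inverses(2)[OF perm] by (simp add: t_def)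
  have bij: "bij_betw ?s {..<?n} {..<?n}"
    using permutes_imp_bij[OF perm] by (simp add: atLeast0LessThan)
  have t_lt: "t j < ?n" if "j < ?n" for j
    using permutes_in_image[OF permutes_inv[OF perm], of j] that by (simp add: t_def)
  show ?thesis
  proof (rule that[of "\<lambda>j. a $ t j"])
    show "\<exists>k<?n. a $ t j = a $ k" if "j < ?n" for j using t_lt[OF that] by blast
    fix i assume i: "i < ?n"
    have "(map_mat real_of_int (cell_mat M B) *\<^sub>v a) $ i =
        (\<Sum>k<?n. of_int (cell_mat M B $$ (i, k)) * a $ k)"
      using i a cell_mat_carrier[OF B] by (simp add: scalar_prod_def atLeast0LessThan)
    also have "\<dots> = (\<Sum>k<?n. of_int (full_rep_mat M $$ (i, ?s k)) *
        (if i < ?r \<longleftrightarrow> ?s k \<in> B then a $ t (?s k) else 0))"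
    proof (rule sum.cong[OF refl])
      fix k assume "k \<in> {..<?n}"
      then have k: "k < ?n" by simp
      have "?s k \<in> B \<longleftrightarrow> k < ?r"
        using k basis_enum_in_B[OF B, of k] basis_enum_notin_B[OF B, of k] by (cases "k < ?r") auto
      then show "of_int (cell_mat M B $$ (i, k)) * a $ k = of_int (full_rep_mat M $$ (i, ?s k)) *
          (if i < ?r \<longleftrightarrow> ?s k \<in> B then a $ t (?s k) else 0)"
        using cell_mat_index[OF B i k] by (simp add: t)
    qed
    also have "\<dots> = (\<Sum>j<?n. of_int (full_rep_mat M $$ (i, j)) * (if i < ?r \<longleftrightarrow> j \<in> B then a $ t j else 0))"
      by (rule sum.reindex_bij_betw[OF bij])
    finally show "(map_mat real_of_int (cell_mat M B) *\<^sub>v a) $ i =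
        (\<Sum>j<?n. of_int (full_rep_mat M $$ (i, j)) * (if i < ?r \<longleftrightarrow> j \<in> B then a $ t j else 0))" .
  qed
qed

text \<open>If \<open>v\<close> is nonzero it outweighs the remaining part of each factor, which
  lies strictly between -1 and 1, so the factors have opposite signs. If \<open>v\<close> is 0, the
  product is 0 when \<open>b\<close> and \<open>c\<close> agree and \<open>- (p * q)\<close> when
  they differ.\<close>

lemma open_unit_integer_product:
  fixes p q :: real and v :: int and b c :: bool
  assumes "0 < p" "p < 1" "0 < q" "q < 1"
  defines "t \<equiv> ((if b then p else 0) - (if c then q else 0) - of_int v) *
    ((if b then 0 else p) - (if c then 0 else q) + of_int v)"
  shows "t \<le> 0" and "t = 0 \<Longrightarrow> (b \<longleftrightarrow> c) \<and> v = 0"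
proof -
  have "t < 0 \<or> (b \<longleftrightarrow> c) \<and> v = 0"
  proof -
    consider "v = 0" | "1 \<le> v" | "v \<le> -1" by linarith
    then show ?thesis
    proof cases
      case 1
      then show ?thesis using assms by (cases b; cases c) (auto simp: mult_pos_neg mult_neg_pos)
    next
      case 2
      then have "1 \<le> real_of_int v" by simp
      then show ?thesis unfolding t_def using assms(1-4)
        by (intro disjI1 mult_neg_pos) (auto split: if_splits)
    next
      case 3
      then have "real_of_int v \<le> -1" by simp
      then show ?thesis unfolding t_def using assms(1-4)
        by (intro disjI1 mult_pos_neg) (auto split: if_splits)
    qed
  qed
  moreover have "t = 0" if "(b \<longleftrightarrow> c) \<and> v = 0" using that by (auto simp: t_def)
  ultimately show "t \<le> 0" "t = 0 \<Longrightarrow> (b \<longleftrightarrow> c) \<and> v = 0" by auto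
qed

lemma cell_interiors_disjoint:
  fixes a a' :: "real vec"
  assumes B: "B \<subseteq> {0..<ground_size M}" "card B = row_num M"
    and B': "B' \<subseteq> {0..<ground_size M}" "card B' = row_num M"
    and a: "a \<in> carrier_vec (ground_size M)" "\<And>i. i < ground_size M \<Longrightarrow> 0 < a $ i \<and> a $ i < 1"
    and a': "a' \<in> carrier_vec (ground_size M)" "\<And>i. i < ground_size M \<Longrightarrow> 0 < a' $ i \<and> a' $ i < 1"
    and u: "u \<in> carrier_vec (ground_size M)"
    and eq: "map_mat real_of_int (cell_mat M B) *\<^sub>v a =
      map_mat real_of_int (cell_mat M B') *\<^sub>v a' + map_vec real_of_int ((full_rep_mat M)\<^sup>T *\<^sub>v u)"
  shows "B = B'" and "u = 0\<^sub>v (ground_size M)"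
proof -
  let ?n = "ground_size M" and ?r = "row_num M"
  let ?A = "\<lambda>i j. real_of_int (full_rep_mat M $$ (i, j))"
  obtain e where
    e0: "\<And>j. j < ?n \<Longrightarrow> \<exists>k<?n. e j = a $ k" and
    e: "\<And>i. i < ?n \<Longrightarrow> (map_mat real_of_int (cell_mat M B) *\<^sub>v a) $ i =
      (\<Sum>j<?n. ?A i j * (if i < ?r \<longleftrightarrow> j \<in> B then e j else 0))"
    by (rule cell_mat_mult_vec_index[OF B a(1)]) (rule that)
  obtain e' where
    e0': "\<And>j. j < ?n \<Longrightarrow> \<exists>k<?n. e' j = a' $ k" and
    e': "\<And>i. i < ?n \<Longrightarrow> (map_mat real_of_int (cell_mat M B') *\<^sub>v a') $ i =
      (\<Sum>j<?n. ?A i j * (if i < ?r \<longleftrightarrow> j \<in> B' then e' j else 0))"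
    by (rule cell_mat_mult_vec_index[OF B' a'(1)]) (rule that)
  have e01: "0 < e j" "e j < 1" if "j < ?n" for j using e0[OF that] a(2) by auto
  have e01': "0 < e' j" "e' j < 1" if "j < ?n" for j using e0'[OF that] a'(2) by auto
  \<comment> \<open>With this sign change the lattice vector becomes \<open>(D v, - D' v)\<close>.\<close>
  define v where "v j = (if j < ?r then u $ j else - u $ j)" for j
  \<comment> \<open>Transposition negates the off-diagonal blocks. Negating the lower coordinates of
    \<open>u\<close> makes up for this in the upper rows, and up to a common sign in the lower
    rows.\<close>
  have lat: "real_of_int (((full_rep_mat M)\<^sup>T *\<^sub>v u) $ i) =
      (\<Sum>j<?n. ?A i j * (if i < ?r then of_int (v j) else - of_int (v j)))" if i: "i < ?n" for i
  proof -
    have "((full_rep_mat M)\<^sup>T *\<^sub>v u) $ i = (\<Sum>j<?n. full_rep_mat M $$ (j, i) * u $ j)"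
      using i u by (simp add: scalar_prod_def atLeast0LessThan)
    also have "\<dots> = (\<Sum>j<?n. full_rep_mat M $$ (i, j) * (if i < ?r then v j else - v j))"
    proof (rule sum.cong[OF refl])
      fix j assume "j \<in> {..<?n}"
      then have j: "j < ?n" by simp
      show "full_rep_mat M $$ (j, i) * u $ j = full_rep_mat M $$ (i, j) * (if i < ?r then v j else - v j)"
      proof (cases "i < ?r \<longleftrightarrow> j < ?r")
        case True
        then have "full_rep_mat M $$ (i, j) = (if i = j then 1 else 0)"
          "full_rep_mat M $$ (j, i) = (if i = j then 1 else 0)"
          using full_rep_mat_skew[OF i j] full_rep_mat_skew[OF j i] by auto
        then show ?thesis using True by (simp add: v_def)
      next
        case False
        then have "full_rep_mat M $$ (j, i) = - full_rep_mat M $$ (i, j)"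
          using full_rep_mat_skew[OF i j] by simp
        then show ?thesis using False by (auto simp: v_def)
      qed
    qed
    also have "real_of_int \<dots> = (\<Sum>j<?n. ?A i j * (if i < ?r then of_int (v j) else - of_int (v j)))"
      by (auto intro!: sum.cong)
    finally show ?thesis .
  qed
  have rows: "(\<Sum>j<?n. ?A i j * (if i < ?r \<longleftrightarrow> j \<in> B then e j else 0)) =
      (\<Sum>j<?n. ?A i j * (if i < ?r \<longleftrightarrow> j \<in> B' then e' j else 0)) +
      (\<Sum>j<?n. ?A i j * (if i < ?r then of_int (v j) else - of_int (v j)))" if i: "i < ?n" for i
  proof -
    have "(map_mat real_of_int (cell_mat M B) *\<^sub>v a) $ i =
        (map_mat real_of_int (cell_mat M B') *\<^sub>v a') $ i + real_of_int (((full_rep_mat M)\<^sup>T *\<^sub>v u) $ i)"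
      unfolding eq using i cell_mat_carrier[OF B'] by simp
    then show ?thesis unfolding e[OF i] e'[OF i] lat[OF i] .
  qed
  \<comment> \<open>These are the two kernel vectors: \<open>x\<close> collects the coordinates on
    the bases minus \<open>v\<close>, and \<open>y\<close> those on the complements plus
    \<open>v\<close>.\<close>
  define x where "x j = (if j \<in> B then e j else 0) - (if j \<in> B' then e' j else 0) - of_int (v j)" for j
  define y where "y j = (if j \<in> B then 0 else e j) - (if j \<in> B' then 0 else e' j) + of_int (v j)" for j
  have gs: "?r \<le> ?n" by (simp add: ground_size_def row_num_def)
  have "(\<Sum>j<?n. x j * y j) = 0"
  proof (rule full_rep_mat_kernels_orthogonal)
    fix i assume i: "i < ?r"
    then show "(\<Sum>j<?n. ?A i j * x j) = 0"
      using rows[of i] gs unfolding x_def by (simp add: right_diff_distrib sum_subtractf)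
  next
    fix i assume i: "?r \<le> i" "i < ?n"
    have "(\<Sum>j<?n. ?A i j * y j) = (\<Sum>j<?n. ?A i j * (if i < ?r \<longleftrightarrow> j \<in> B then e j else 0)) -
        (\<Sum>j<?n. ?A i j * (if i < ?r \<longleftrightarrow> j \<in> B' then e' j else 0)) -
        (\<Sum>j<?n. ?A i j * (if i < ?r then of_int (v j) else - of_int (v j)))"
      unfolding y_def sum_subtractf[symmetric] using i by (intro sum.cong) (auto simp: algebra_simps)
    then show "(\<Sum>j<?n. ?A i j * y j) = 0" using rows[OF i(2)] by simp
  qed
  moreover have le: "x j * y j \<le> 0" if "j < ?n" for j
    unfolding x_def y_def by (rule open_unit_integer_product(1)) (use e01 e01' that in auto)
  ultimately have zero: "x j * y j = 0" if "j < ?n" for j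
    using that sum_nonneg_eq_0_iff[of "{..<?n}" "\<lambda>j. - (x j * y j)"] by (auto simp: sum_negf)
  have agree: "(j \<in> B \<longleftrightarrow> j \<in> B') \<and> v j = 0" if "j < ?n" for j
    by (rule open_unit_integer_product(2)[of "e j" "e' j"])
      (use e01 e01' that zero[OF that] in \<open>auto simp: x_def y_def\<close>)
  then show "B = B'" using B(1) B'(1) by auto
  show "u = 0\<^sub>v ?n"
  proof (rule eq_vecI)
    fix i assume "i < dim_vec (0\<^sub>v ?n :: int vec)"
    then show "u $ i = 0\<^sub>v ?n $ i" using agree[of i] by (simp add: v_def split: if_splits)
  qed (use u in auto)
qed

section \<open>Classes of the sandpile group\<close>

lemma rep_lattice_eq:
  "rep_lattice M = {(full_rep_mat M)\<^sup>T *\<^sub>v u | u. u \<in> carrier_vec (ground_size M)}"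
proof -
  have T: "(full_rep_mat M)\<^sup>T \<in> carrier_mat (ground_size M) (ground_size M)" by simp
  have "rep_lattice M = vec_module.lattice_of (ground_size M) (cols (full_rep_mat M)\<^sup>T)"
    unfolding rep_lattice_def by simp
  also have "\<dots> = {y \<in> carrier_vec (ground_size M). \<exists>u\<in>carrier_vec (ground_size M). (full_rep_mat M)\<^sup>T *\<^sub>v u = y}"
    unfolding lattice_of_cols_as_mat_mult[OF T] by simp
  also have "\<dots> = {(full_rep_mat M)\<^sup>T *\<^sub>v u | u. u \<in> carrier_vec (ground_size M)}"
    using mult_mat_vec_carrier[OF T] by blast
  finally show ?thesis .
qed

definition lattice_class :: "int mat \<Rightarrow> int vec \<Rightarrow> int vec set" where
  "lattice_class M x = {y \<in> carrier_vec (ground_size M). lattice_cong (full_rep_mat M)\<^sup>T x y}"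

text \<open>Lets the rest of the proof work with congruence of integer vectors in place of cosets of
  the quotient group.\<close>

lemma carrier_sandpile_group: "carrier (sandpile_group M) = lattice_class M ` carrier_vec (ground_size M)"
proof -
  let ?n = "ground_size M" and ?T = "(full_rep_mat M)\<^sup>T"
  have "r_coset (monoid_vec TYPE(int) ?n) (rep_lattice M) x = lattice_class M x"
    if x: "x \<in> carrier_vec ?n" for x
  proof -
    have "y \<in> r_coset (monoid_vec TYPE(int) ?n) (rep_lattice M) x \<longleftrightarrow>
        (\<exists>u\<in>carrier_vec ?n. y = ?T *\<^sub>v u + x)" for y
      unfolding r_coset_def rep_lattice_eq monoid_vec_simps by blast
    moreover have "(\<exists>u\<in>carrier_vec ?n. y = ?T *\<^sub>v u + x) \<longleftrightarrow> y \<in> carrier_vec ?n \<and> lattice_cong ?T y x" for y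
    proof -
      have "?T *\<^sub>v u + x = x + ?T *\<^sub>v u" "x + ?T *\<^sub>v u \<in> carrier_vec ?n" if "u \<in> carrier_vec ?n" for u
        using x that mult_mat_vec_carrier[of ?T ?n ?n u] by (auto intro: comm_add_vec)
      then show ?thesis unfolding lattice_cong_def by auto
    qed
    moreover have "lattice_cong ?T y x \<longleftrightarrow> lattice_cong ?T x y" if "y \<in> carrier_vec ?n" for y
      using lattice_cong_sym[of ?T] x that by auto
    ultimately show ?thesis unfolding lattice_class_def by blast
  qed
  then show ?thesis
    unfolding sandpile_group_def FactGroup_def RCOSETS_def by (auto simp: monoid_vec_simps)
qed

lemma lattice_class_eq:
  assumes "x \<in> carrier_vec (ground_size M)" and "y \<in> lattice_class M x"
  shows "lattice_class M y = lattice_class M x"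
proof -
  let ?T = "(full_rep_mat M)\<^sup>T"
  have y: "y \<in> carrier_vec (ground_size M)" and xy: "lattice_cong ?T x y"
    using assms(2) by (simp_all add: lattice_class_def)
  have yx: "lattice_cong ?T y x" by (rule lattice_cong_sym[OF xy]) (simp add: y)
  have "lattice_cong ?T y z \<longleftrightarrow> lattice_cong ?T x z" if z: "z \<in> carrier_vec (ground_size M)" for z
    using lattice_cong_trans[OF xy, of z] lattice_cong_trans[OF yx, of z] z by auto
  then show ?thesis unfolding lattice_class_def by blast
qed

text \<open>The columns of the identity block of \<open>D\<close>. They supply a nonzero term in the
  sum of squares, so the sandpile lattice has full rank.\<close>

lemma initial_basis: "{0..<row_num M} \<in> bases M"
proof -
  let ?B = "{0..<row_num M}"
  have B: "?B \<subseteq> {0..<ground_size M}" "card ?B = row_num M" by (auto simp: ground_size_def row_num_def)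
  have "split_mat M ?B = 1\<^sub>m (ground_size M)"
    by (rule eq_matI) (auto simp: split_mat_def full_rep_mat_index std_rep_mat_index dual_rep_mat_index
        ground_size_def row_num_def)
  then have "(basis_det M ?B)\<^sup>2 = 1" using det_split_mat[OF B] by simp
  then show ?thesis using B by (auto simp: bases_def)
qed

lemma finite_bases: "finite (bases M)"
  by (rule finite_subset[of _ "Pow {0..<ground_size M}"]) (auto simp: bases_def)

lemma nat_det_full_rep_mat:
  "det (full_rep_mat M) > 0" "nat \<bar>det (full_rep_mat M)\<bar> = (\<Sum>B\<in>bases M. (basis_mult M B)\<^sup>2)"
proof -
  have "basis_det M {0..<row_num M} \<noteq> 0" using initial_basis[of M] by (auto simp: bases_def)
  then show pos: "det (full_rep_mat M) > 0"
    unfolding det_full_rep_mat by (intro sum_pos2[OF finite_bases initial_basis]) auto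
  have "int (\<Sum>B\<in>bases M. (basis_mult M B)\<^sup>2) = det (full_rep_mat M)"
    unfolding det_full_rep_mat by (simp add: basis_mult_def)
  then show "nat \<bar>det (full_rep_mat M)\<bar> = (\<Sum>B\<in>bases M. (basis_mult M B)\<^sup>2)" using pos by linarith
qed

section \<open>The points associated with each basis, for a fixed shifting vector\<close>

context
  fixes M :: "int mat" and w :: "real vec"
  assumes shifting: "shifting_vector M w"
begin

text \<open>The dimension is required explicitly: a sum of vectors takes its dimension from the
  second summand, so \<open>w_associated\<close> alone does not constrain that of
  \<open>z\<close>.\<close>

definition associated_points :: "nat set \<Rightarrow> int vec set" where
  "associated_points B = {z \<in> carrier_vec (ground_size M). w_associated M w z B}"

lemma basis_cell_inverse:
  assumes B: "B \<in> bases M"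
  obtains K where "K \<in> carrier_mat (ground_size M) (ground_size M)"
    and "map_mat real_of_int (cell_mat M B) * K = 1\<^sub>m (ground_size M)"
    and "K * map_mat real_of_int (cell_mat M B) = 1\<^sub>m (ground_size M)"
    and "\<And>i. i < ground_size M \<Longrightarrow> (K *\<^sub>v w) $ i \<noteq> 0"
proof -
  have B': "B \<subseteq> {0..<ground_size M}" "card B = row_num M" "basis_det M B \<noteq> 0"
    using B by (auto simp: bases_def)
  let ?H = "map_mat real_of_int (cell_mat M B)"
  have H: "?H \<in> carrier_mat (ground_size M) (ground_size M)" using cell_mat_carrier[OF B'(1,2)] by simp
  have "det (cell_mat M B) \<noteq> 0" using B'(3) det_cell_mat[OF B'(1,2)] by (simp add: sign_def)
  then have "det ?H \<noteq> 0" by simp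
  from det_nonzero_inverse[OF H this] obtain K where K: "K \<in> carrier_mat (ground_size M) (ground_size M)"
    "?H * K = 1\<^sub>m (ground_size M)" "K * ?H = 1\<^sub>m (ground_size M)" by blast
  have "(K *\<^sub>v w) $ i \<noteq> 0" if "i < ground_size M" for i
  proof (rule generic_coordinate_nonzero[OF H K _ that])
    show "w \<in> carrier_vec (ground_size M)" using shifting by (simp add: shifting_vector_def)
    show "w \<notin> direction_space (ground_size M) F"
      if "is_facet (ground_size M) F (fund_parallelepiped ?H)" for F
      using shifting B that unfolding shifting_vector_def basis_cell_eq_fund_parallelepiped[OF B'(1,2), symmetric]
      by blast
  qed
  then show ?thesis using that K by blast
qed

lemma card_associated_points:
  assumes B: "B \<in> bases M"
  shows "finite (associated_points B)" and "card (associated_points B) = (basis_mult M B)\<^sup>2"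
proof -
  have B': "B \<subseteq> {0..<ground_size M}" "card B = row_num M" "basis_det M B \<noteq> 0"
    using B by (auto simp: bases_def)
  let ?H = "map_mat real_of_int (cell_mat M B)"
  have C: "cell_mat M B \<in> carrier_mat (ground_size M) (ground_size M)" by (rule cell_mat_carrier[OF B'(1,2)])
  then have H: "?H \<in> carrier_mat (ground_size M) (ground_size M)" by simp
  have w: "w \<in> carrier_vec (ground_size M)" using shifting by (simp add: shifting_vector_def)
  obtain K where K: "K \<in> carrier_mat (ground_size M) (ground_size M)"
    "?H * K = 1\<^sub>m (ground_size M)" "K * ?H = 1\<^sub>m (ground_size M)"
    and gen: "\<And>i. i < ground_size M \<Longrightarrow> (K *\<^sub>v w) $ i \<noteq> 0"
    by (rule basis_cell_inverse[OF B]) (rule that)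
  have "transversal (cell_mat M B) (associated_points B)"
    using transversal_fund_parallelepiped[OF H K w gen C refl]
    unfolding associated_points_def w_associated_def basis_cell_eq_fund_parallelepiped[OF B'(1,2)] .
  moreover have "det (cell_mat M B) \<noteq> 0" using B'(3) det_cell_mat[OF B'(1,2)] by (simp add: sign_def)
  ultimately show "finite (associated_points B)" "card (associated_points B) = (basis_mult M B)\<^sup>2"
    using card_transversal[OF C] abs_det_cell_mat[OF B'(1,2)] by auto
qed

text \<open>Excludes oscillation. Lying in the union \<open>tile M\<close> for all small \<epsilon>
  would otherwise allow the cell to vary with \<epsilon>; by this dichotomy one of the finitely many
  cells must serve throughout.\<close>

lemma w_associated_cases:
  assumes B: "B \<in> bases M" and z: "z \<in> carrier_vec (ground_size M)"
  shows "w_associated M w z B \<or>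
    (\<forall>\<^sub>F \<epsilon> in at_right 0. map_vec real_of_int z + \<epsilon> \<cdot>\<^sub>v w \<notin> basis_cell M B)"
proof -
  have B': "B \<subseteq> {0..<ground_size M}" "card B = row_num M"
    using B by (auto simp: bases_def)
  let ?H = "map_mat real_of_int (cell_mat M B)"
  have H: "?H \<in> carrier_mat (ground_size M) (ground_size M)" using cell_mat_carrier[OF B'] by simp
  have w: "w \<in> carrier_vec (ground_size M)" using shifting by (simp add: shifting_vector_def)
  obtain K where K: "K \<in> carrier_mat (ground_size M) (ground_size M)"
    "?H * K = 1\<^sub>m (ground_size M)" "K * ?H = 1\<^sub>m (ground_size M)"
    and gen: "\<And>i. i < ground_size M \<Longrightarrow> (K *\<^sub>v w) $ i \<noteq> 0"
    by (rule basis_cell_inverse[OF B]) (rule that)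
  have zr: "map_vec real_of_int z \<in> carrier_vec (ground_size M)" using z by simp
  show ?thesis
    using shifted_in_fund_parallelepiped[OF H K w gen zr] shifted_notin_fund_parallelepiped[OF H K w gen zr]
    unfolding w_associated_def basis_cell_eq_fund_parallelepiped[OF B'] by blast
qed

text \<open>Association speaks of closed cells; genericity of \<open>w\<close> upgrades it to
  interior points, as \<open>cell_interiors_disjoint\<close> requires.\<close>

lemma w_associated_interior:
  assumes B: "B \<in> bases M" and z: "z \<in> associated_points B"
  shows "\<forall>\<^sub>F \<epsilon> in at_right 0. \<exists>a\<in>carrier_vec (ground_size M). (\<forall>i<ground_size M. 0 < a $ i \<and> a $ i < 1) \<and>
    map_vec real_of_int z + \<epsilon> \<cdot>\<^sub>v w = map_mat real_of_int (cell_mat M B) *\<^sub>v a"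
proof -
  have B': "B \<subseteq> {0..<ground_size M}" "card B = row_num M"
    using B by (auto simp: bases_def)
  let ?H = "map_mat real_of_int (cell_mat M B)"
  have H: "?H \<in> carrier_mat (ground_size M) (ground_size M)" using cell_mat_carrier[OF B'] by simp
  have w: "w \<in> carrier_vec (ground_size M)" using shifting by (simp add: shifting_vector_def)
  obtain K where K: "K \<in> carrier_mat (ground_size M) (ground_size M)"
    "?H * K = 1\<^sub>m (ground_size M)" "K * ?H = 1\<^sub>m (ground_size M)"
    and gen: "\<And>i. i < ground_size M \<Longrightarrow> (K *\<^sub>v w) $ i \<noteq> 0"
    by (rule basis_cell_inverse[OF B]) (rule that)
  have zr: "map_vec real_of_int z \<in> carrier_vec (ground_size M)" using z by (simp add: associated_points_def)
  have "\<forall>i<ground_size M. shifted_unit ((K *\<^sub>v w) $ i) ((K *\<^sub>v map_vec real_of_int z) $ i)"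
    using z shifted_in_fund_parallelepiped_iff[OF H K w gen zr]
    unfolding associated_points_def w_associated_def basis_cell_eq_fund_parallelepiped[OF B'] by blast
  from shifted_in_interior[OF H K w gen zr this] show ?thesis
  proof (rule eventually_mono)
    fix \<epsilon> let ?x = "map_vec real_of_int z + \<epsilon> \<cdot>\<^sub>v w"
    assume a: "\<forall>i<ground_size M. 0 < (K *\<^sub>v ?x) $ i \<and> (K *\<^sub>v ?x) $ i < 1"
    have "?x \<in> carrier_vec (ground_size M)" using zr w by simp
    from right_inverse_mult_vec[OF H K this] a
    show "\<exists>a\<in>carrier_vec (ground_size M). (\<forall>i<ground_size M. 0 < a $ i \<and> a $ i < 1) \<and> ?x = ?H *\<^sub>v a"
      using mult_mat_vec_carrier[OF K(1) \<open>?x \<in> _\<close>] by (intro bexI[of _ "K *\<^sub>v ?x"]) auto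
  qed
qed

lemma associated_points_cong_unique:
  assumes B: "B \<in> bases M" "B' \<in> bases M"
    and z: "z \<in> associated_points B" "z' \<in> associated_points B'"
    and cong: "lattice_cong (full_rep_mat M)\<^sup>T z z'"
  shows "B = B'" and "z = z'"
proof -
  let ?n = "ground_size M" and ?T = "(full_rep_mat M)\<^sup>T" and ?h = "map_vec real_of_int"
  have Bs: "B \<subseteq> {0..<?n}" "card B = row_num M" "B' \<subseteq> {0..<?n}" "card B' = row_num M"
    using B by (auto simp: bases_def)
  have zc: "z \<in> carrier_vec ?n" "z' \<in> carrier_vec ?n" using z by (auto simp: associated_points_def)
  have w: "w \<in> carrier_vec ?n" using shifting by (simp add: shifting_vector_def)
  from cong obtain u where u: "u \<in> carrier_vec ?n" "z = z' + ?T *\<^sub>v u" by (auto simp: lattice_cong_def)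
  have Tu: "?T *\<^sub>v u \<in> carrier_vec ?n" using u(1) by (intro mult_mat_vec_carrier[of _ ?n ?n]) auto
  \<comment> \<open>Both conditions hold for all sufficiently small \<epsilon>, hence for a common
    one; the equal shifts then cancel in the difference of the two points.\<close>
  obtain \<epsilon> where
    "\<exists>a\<in>carrier_vec ?n. (\<forall>i<?n. 0 < a $ i \<and> a $ i < 1) \<and>
      ?h z + \<epsilon> \<cdot>\<^sub>v w = map_mat real_of_int (cell_mat M B) *\<^sub>v a"
    "\<exists>a\<in>carrier_vec ?n. (\<forall>i<?n. 0 < a $ i \<and> a $ i < 1) \<and>
      ?h z' + \<epsilon> \<cdot>\<^sub>v w = map_mat real_of_int (cell_mat M B') *\<^sub>v a"
    using eventually_happens'[OF trivial_limit_at_right_real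
        eventually_conj[OF w_associated_interior[OF B(1) z(1)] w_associated_interior[OF B(2) z(2)]]]
    by (elim exE conjE) (rule that)
  then obtain a a' where
    a: "a \<in> carrier_vec ?n" "\<And>i. i < ?n \<Longrightarrow> 0 < a $ i \<and> a $ i < 1"
      "?h z + \<epsilon> \<cdot>\<^sub>v w = map_mat real_of_int (cell_mat M B) *\<^sub>v a" and
    a': "a' \<in> carrier_vec ?n" "\<And>i. i < ?n \<Longrightarrow> 0 < a' $ i \<and> a' $ i < 1"
      "?h z' + \<epsilon> \<cdot>\<^sub>v w = map_mat real_of_int (cell_mat M B') *\<^sub>v a'" by (elim bexE conjE) simp
  have "?h z + \<epsilon> \<cdot>\<^sub>v w = (?h z' + \<epsilon> \<cdot>\<^sub>v w) + ?h (?T *\<^sub>v u)"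
    unfolding u(2) using zc(2) w Tu by (intro eq_vecI) auto
  then have eq: "map_mat real_of_int (cell_mat M B) *\<^sub>v a =
      map_mat real_of_int (cell_mat M B') *\<^sub>v a' + ?h (?T *\<^sub>v u)"
    unfolding a(3) a'(3) .
  note disj = cell_interiors_disjoint[OF Bs a(1,2) a'(1,2) u(1) eq]
  show "B = B'" by (rule disj(1))
  have "?T *\<^sub>v 0\<^sub>v ?n = 0\<^sub>v ?n" by (intro eq_vecI) auto
  then show "z = z'" using u(2) zc(2) by (simp only: disj(2) right_zero_vec)
qed

section \<open>Representatives of the classes and the fibres of the map to bases\<close>

lemma w_representative_iff:
  "w_representative M w z \<longleftrightarrow> z \<in> (\<Union>B\<in>bases M. associated_points B)"
proof
  assume rep: "w_representative M w z"
  then have z: "z \<in> carrier_vec (ground_size M)" by (simp add: w_representative_def)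
  show "z \<in> (\<Union>B\<in>bases M. associated_points B)"
  proof (rule ccontr)
    assume "z \<notin> (\<Union>B\<in>bases M. associated_points B)"
    then have "\<forall>\<^sub>F \<epsilon> in at_right 0. map_vec real_of_int z + \<epsilon> \<cdot>\<^sub>v w \<notin> basis_cell M B" if "B \<in> bases M" for B
      using w_associated_cases[OF that z] that z by (auto simp: associated_points_def)
    then have "\<forall>\<^sub>F \<epsilon> in at_right 0. \<forall>B\<in>bases M. map_vec real_of_int z + \<epsilon> \<cdot>\<^sub>v w \<notin> basis_cell M B"
      by (intro eventually_ball_finite[OF finite_bases] ballI)
    moreover have "\<forall>\<^sub>F \<epsilon> in at_right 0. map_vec real_of_int z + \<epsilon> \<cdot>\<^sub>v w \<in> tile M"
      using rep by (simp add: w_representative_def)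
    ultimately have "\<forall>\<^sub>F \<epsilon> in at_right (0::real). False"
      by eventually_elim (simp add: tile_def)
    then show False by simp
  qed
next
  assume "z \<in> (\<Union>B\<in>bases M. associated_points B)"
  then obtain B where B: "B \<in> bases M" "z \<in> carrier_vec (ground_size M)" "w_associated M w z B"
    by (auto simp: associated_points_def)
  from B(3) have "\<forall>\<^sub>F \<epsilon> in at_right 0. map_vec real_of_int z + \<epsilon> \<cdot>\<^sub>v w \<in> tile M"
    unfolding w_associated_def by (rule eventually_mono) (use B(1) in \<open>auto simp: tile_def\<close>)
  then show "w_representative M w z" using B(2) by (simp add: w_representative_def)
qed

text \<open>The points associated with all bases are pairwise incongruent and their number is the
  sum of the squared multiplicities, which is the index of the sandpile lattice. Pigeonhole gives a
  representative in every class.\<close>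

lemma transversal_w_representatives:
  "transversal (full_rep_mat M)\<^sup>T {z. w_representative M w z}"
proof -
  let ?R = "\<Union>B\<in>bases M. associated_points B" and ?n = "ground_size M"
  have T: "(full_rep_mat M)\<^sup>T \<in> carrier_mat ?n ?n" by simp
  have det: "det (full_rep_mat M)\<^sup>T = det (full_rep_mat M)" by (rule det_transpose[OF full_rep_mat_carrier])
  have "card ?R = (\<Sum>B\<in>bases M. card (associated_points B))"
  proof (rule card_UN_disjoint[OF finite_bases])
    show "\<forall>B\<in>bases M. finite (associated_points B)" using card_associated_points by blast
    show "\<forall>B\<in>bases M. \<forall>B'\<in>bases M. B \<noteq> B' \<longrightarrow> associated_points B \<inter> associated_points B' = {}"
    proof (intro ballI impI, rule ccontr)
      fix B B' assume B: "B \<in> bases M" "B' \<in> bases M" "B \<noteq> B'" "associated_points B \<inter> associated_points B' \<noteq> {}"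
      then obtain z where z: "z \<in> associated_points B" "z \<in> associated_points B'" by blast
      \<comment> \<open>Disjointness is the case of the zero lattice vector: a common point is
        congruent to itself.\<close>
      then have "lattice_cong (full_rep_mat M)\<^sup>T z z"
        by (intro lattice_cong_refl) (simp add: associated_points_def)
      then show False using associated_points_cong_unique(1)[OF B(1,2) z] B(3) by blast
    qed
  qed
  also have "\<dots> = nat \<bar>det (full_rep_mat M)\<^sup>T\<bar>"
    unfolding det nat_det_full_rep_mat(2) using card_associated_points(2) by (intro sum.cong) auto
  finally have "card ?R = nat \<bar>det (full_rep_mat M)\<^sup>T\<bar>" .
  moreover have "det (full_rep_mat M)\<^sup>T \<noteq> 0" unfolding det using nat_det_full_rep_mat(1)[of M] by simp
  moreover have "finite ?R" using finite_bases card_associated_points(1) by blast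
  moreover have "?R \<subseteq> carrier_vec ?n" by (auto simp: associated_points_def)
  moreover have "x = y" if "x \<in> ?R" "y \<in> ?R" "lattice_cong (full_rep_mat M)\<^sup>T x y" for x y
    using that associated_points_cong_unique(2) by blast
  ultimately have "transversal (full_rep_mat M)\<^sup>T ?R" by (intro transversalI_card[OF T])
  moreover have "{z. w_representative M w z} = ?R" using w_representative_iff by blast
  ultimately show ?thesis by simp
qed

lemma ex1_w_representative:
  assumes "s \<in> carrier (sandpile_group M)"
  shows "\<exists>!z. z \<in> s \<and> w_representative M w z"
proof -
  from assms obtain x where x: "x \<in> carrier_vec (ground_size M)" "s = lattice_class M x"
    by (auto simp: carrier_sandpile_group)
  then have "\<exists>!y. y \<in> {z. w_representative M w z} \<and> lattice_cong (full_rep_mat M)\<^sup>T x y"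
    using transversal_w_representatives by (simp add: transversal_def)
  moreover have "z \<in> s \<and> w_representative M w z \<longleftrightarrow>
      z \<in> {z. w_representative M w z} \<and> lattice_cong (full_rep_mat M)\<^sup>T x z" for z
    unfolding x(2) lattice_class_def by (auto simp: w_representative_def)
  ultimately show ?thesis by simp
qed

lemma class_rep_props:
  assumes "s \<in> carrier (sandpile_group M)"
  shows "class_rep M w s \<in> s" and "w_representative M w (class_rep M w s)"
  using theI'[OF ex1_w_representative[OF assms]] unfolding class_rep_def by auto

lemma ex1_basis_of_class_rep:
  assumes "s \<in> carrier (sandpile_group M)"
  shows "\<exists>!B. B \<in> bases M \<and> w_associated M w (class_rep M w s) B"
proof -
  let ?z = "class_rep M w s"
  have rep: "w_representative M w ?z" by (rule class_rep_props(2)[OF assms])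
  then have zc: "?z \<in> carrier_vec (ground_size M)" by (simp add: w_representative_def)
  from rep obtain B where B: "B \<in> bases M" "?z \<in> associated_points B"
    unfolding w_representative_iff by blast
  have "lattice_cong (full_rep_mat M)\<^sup>T ?z ?z" by (rule lattice_cong_refl) (simp add: zc)
  then have uniq: "B' = B" if "B' \<in> bases M" "?z \<in> associated_points B'" for B'
    by (rule associated_points_cong_unique(1)[OF that(1) B(1) that(2) B(2)])
  have "w_associated M w ?z B' \<longleftrightarrow> ?z \<in> associated_points B'" for B'
    using zc by (simp add: associated_points_def)
  then show ?thesis using B uniq by blast
qed

lemma basis_map_props:
  assumes "s \<in> carrier (sandpile_group M)"
  shows "basis_map M w s \<in> bases M" and "class_rep M w s \<in> associated_points (basis_map M w s)"
  using theI'[OF ex1_basis_of_class_rep[OF assms]] class_rep_props(2)[OF assms]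
  unfolding basis_map_def associated_points_def w_representative_def by auto

text \<open>Taking the class of a point and taking the representative of a class are mutually
  inverse between the points associated with \<open>B\<close> and the fibre over
  \<open>B\<close>.\<close>

lemma card_basis_map_fibre:
  assumes B: "B \<in> bases M"
  shows "card {s \<in> carrier (sandpile_group M). basis_map M w s = B} = (basis_mult M B)\<^sup>2"
proof -
  let ?F = "{s \<in> carrier (sandpile_group M). basis_map M w s = B}"
  have point: "lattice_class M z \<in> carrier (sandpile_group M) \<and> class_rep M w (lattice_class M z) = z \<and>
      basis_map M w (lattice_class M z) = B" if z: "z \<in> associated_points B" for z
  proof (intro conjI)
    have zc: "z \<in> carrier_vec (ground_size M)" using z by (simp add: associated_points_def)
    then show s: "lattice_class M z \<in> carrier (sandpile_group M)" by (simp add: carrier_sandpile_group)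
    have "z \<in> lattice_class M z" using lattice_cong_refl[of z "(full_rep_mat M)\<^sup>T"] zc
      by (simp add: lattice_class_def)
    moreover have "w_representative M w z" using z B by (auto simp: w_representative_iff)
    ultimately show rep: "class_rep M w (lattice_class M z) = z"
      using ex1_w_representative[OF s] class_rep_props[OF s] by blast
    show "basis_map M w (lattice_class M z) = B"
      using ex1_basis_of_class_rep[OF s] basis_map_props[OF s] z B unfolding rep
      by (auto simp: associated_points_def)
  qed
  have "bij_betw (lattice_class M) (associated_points B) ?F"
  proof (rule bij_betw_byWitness[where f' = "class_rep M w"])
    show "\<forall>z\<in>associated_points B. class_rep M w (lattice_class M z) = z"
      "lattice_class M ` associated_points B \<subseteq> ?F" using point by auto
    show "class_rep M w ` ?F \<subseteq> associated_points B" using basis_map_props(2) by blast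
    show "\<forall>s\<in>?F. lattice_class M (class_rep M w s) = s"
    proof
      fix s assume "s \<in> ?F"
      then have s: "s \<in> carrier (sandpile_group M)" by simp
      then obtain x where x: "x \<in> carrier_vec (ground_size M)" "s = lattice_class M x"
        by (auto simp: carrier_sandpile_group)
      show "lattice_class M (class_rep M w s) = s"
        using lattice_class_eq[OF x(1)] class_rep_props(1)[OF s] unfolding x(2) .
    qed
  qed
  then show ?thesis using bij_betw_same_card card_associated_points(2)[OF B] by fastforce
qed

end

theorem theorem6p10:
  fixes r n :: nat and M :: "int mat" and w :: "real vec"
  assumes "r \<le> n" and "M \<in> carrier_mat r (n - r)" and "shifting_vector M w"
  shows "(\<forall>s\<in>carrier (sandpile_group M).
            (\<exists>!z. z \<in> s \<and> w_representative M w z) \<and>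
            (\<exists>!B. B \<in> bases M \<and> w_associated M w (class_rep M w s) B)) \<and>
         basis_map M w \<in> carrier (sandpile_group M) \<rightarrow> bases M \<and>
         (\<forall>B\<in>bases M. card {s \<in> carrier (sandpile_group M). basis_map M w s = B}
            = (basis_mult M B)\<^sup>2)"
  using ex1_w_representative[OF assms(3)] ex1_basis_of_class_rep[OF assms(3)]
    basis_map_props(1)[OF assms(3)] card_basis_map_fibre[OF assms(3)] by blast

end
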